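(* Let $\mathfrak{R}$ be a complete, separated topological associative ring, let $R$ be an associative ring, and let $\theta\colon R\to\mathfrak{R}$ be a ring homomorphism with a dense image. Assume that $\mathfrak{R}$ has a countable base of neighborhoods of zero consisting of open two-sided ideals, each of which, viewed as a right ideal, is strongly generated by a finite set of elements lying in the image of the map $\theta$. Then the forgetful functor $\mathfrak{R}\text{-}\mathrm{Contra}\to R\text{-}\mathrm{Mod}$ from the category of left $\mathfrak{R}$-contramodules to the category of left $R$-modules is fully faithful.
   Context: Let $\mathfrak{R}$ be a complete, separated topological associative ring with a base of neighborhoods of zero formed by open right ideals. For a set $X$, let $\mathfrak{R}[[X]]=\varprojlim_{\mathfrak{J}}(\mathfrak{R}/\mathfrak{J})[X]$, where $\mathfrak{J}$ ranges over the open right ideals and $A[X]$ denotes the direct sum of $X$ copies of an abelian group $A$. Thus $\mathfrak{R}[[X]]$ is the set of all infinite formal linear combinations $\sum_{x\in X}r_xx$ with $r_x\in\mathfrak{R}$ converging to zero, i.e. for every open neighborhood $\mathfrak{U}$ of $0$ the set $\{x: r_x\notin\mathfrak{U}\}$ is finite. The assignment $X\mapsto\mathfrak{R}[[X]]$ is a functor $\mathrm{Sets}\to\mathrm{Sets}$ (a map $f\colon X\to Y$ induces $\sum_x r_xx\mapsto\sum_y\bigl(\sum_{f(x)=y}r_x\bigr)y$, the inner sums being limits of finite partial sums). It is a monad: the unit $X\to\mathfrak{R}[[X]]$ sends $x$ to the formal combination with coefficient $1$ at $x$ and $0$ elsewhere, and the multiplication $\mathfrak{R}[[\mathfrak{R}[[X]]]]\to\mathfrak{R}[[X]]$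 opens parentheses, using multiplication in $\mathfrak{R}$ and infinite sums understood as limits of finite partial sums. A left $\mathfrak{R}$-contramodule is an algebra over this monad, i.e. a set $C$ with a map $\pi_C\colon\mathfrak{R}[[C]]\to C$ satisfying the associativity and unitality equations; morphisms are morphisms of algebras over the monad. They form the abelian category $\mathfrak{R}\text{-}\mathrm{Contra}$. Every left $\mathfrak{R}$-contramodule has an underlying left $\mathfrak{R}$-module structure (obtained by restricting $\pi_C$ to finite formal linear combinations), and hence, via $\theta$, a left $R$-module structure; this defines the forgetful functor. A finite set of elements $s_1,\dots,s_m$ of a right ideal $\mathfrak{J}\subset\mathfrak{R}$ strongly generates $\mathfrak{J}$ if for every set $X$ and every family $(r_x\in\mathfrak{J})_{x\in X}$ converging to zero in the topology of $\mathfrak{R}$ there exist families $(r_{j,x}\in\mathfrak{R})_{x\in X}$, $j=1,\dots,m$, each converging to zero in the topology of $\mathfrak{R}$, such that $r_x=\sum_{j=1}^ms_jr_{j,x}$ for all $x\in X$. *)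

theory Defs
  imports "HOL-Analysis.Analysis"
begin

section \<open>Rings\<close>

text \<open>
  Associative rings with unit. Unlike \<^class>\<open>ring_1\<close>, this class admits the zero ring.
\<close>

class unital_ring = ring + monoid_mult

definition unital_ring_hom :: "('a::unital_ring \<Rightarrow> 'b::unital_ring) \<Rightarrow> bool" where
  "unital_ring_hom f \<longleftrightarrow>
     (\<forall>x y. f (x + y) = f x + f y) \<and> (\<forall>x y. f (x * y) = f x * f y) \<and> f 1 = 1"

text \<open>
  The uniform structure in \<^class>\<open>uniform_topological_group_add\<close> is necessarily the one of the
  topological group: it induces the topology and makes addition and negation uniformly continuous.
  So \<^class>\<open>complete_uniform_space\<close> is completeness of the additive group, and
  \<^class>\<open>t2_space\<close> is separatedness.
\<close>

class complete_separated_topological_ring =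
  unital_ring + topological_ab_group_add + topological_monoid_mult +
  uniform_topological_group_add + complete_uniform_space + t2_space

definition right_ideal :: "'r::unital_ring set \<Rightarrow> bool" where
  "right_ideal J \<longleftrightarrow> 0 \<in> J \<and> (\<forall>x\<in>J. \<forall>y\<in>J. x - y \<in> J) \<and> (\<forall>x\<in>J. \<forall>r. x * r \<in> J)"

definition two_sided_ideal :: "'r::unital_ring set \<Rightarrow> bool" where
  "two_sided_ideal J \<longleftrightarrow> right_ideal J \<and> (\<forall>x\<in>J. \<forall>r. r * x \<in> J)"

definition base_at_zero :: "'r::{zero, topological_space} set set \<Rightarrow> bool" where
  "base_at_zero B \<longleftrightarrow>
     (\<forall>V\<in>B. eventually (\<lambda>x. x \<in> V) (nhds 0)) \<and> (\<forall>U. open U \<and> 0 \<in> U \<longrightarrow> (\<exists>V\<in>B. V \<subseteq> U))"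


section \<open>Families converging to zero and strong generation\<close>

definition converges_to_zero :: "'x set \<Rightarrow> ('x \<Rightarrow> 'r::{zero, topological_space}) \<Rightarrow> bool" where
  "converges_to_zero X r \<longleftrightarrow> (\<forall>U. open U \<and> 0 \<in> U \<longrightarrow> finite {x \<in> X. r x \<notin> U})"

definition strongly_generates_over ::
    "'r::complete_separated_topological_ring set \<Rightarrow> 'r set \<Rightarrow> 'x set \<Rightarrow> bool" where
  "strongly_generates_over S J X \<longleftrightarrow>
     (\<forall>r. (\<forall>x\<in>X. r x \<in> J) \<and> converges_to_zero X r \<longrightarrow>
       (\<exists>t. (\<forall>s\<in>S. converges_to_zero X (t s)) \<and> (\<forall>x\<in>X. r x = (\<Sum>s\<in>S. s * t s x))))"

text \<open>
  A formula cannot quantify over index sets of all types. Subsets of \<^typ>\<open>'r \<times> nat\<close> suffice: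
  in a family converging to zero every nonzero value is taken only finitely often. The lemma
  \<open>strongly_generates_arbitrary_index\<close> below derives the condition for index sets of every type.
\<close>

definition strongly_generates ::
    "'r::complete_separated_topological_ring set \<Rightarrow> 'r set \<Rightarrow> bool" where
  "strongly_generates S J \<longleftrightarrow>
     right_ideal J \<and> finite S \<and> S \<subseteq> J \<and> (\<forall>X :: ('r \<times> nat) set. strongly_generates_over S J X)"

lemma strongly_generates_arbitrary_index:
  fixes S J :: "'r::complete_separated_topological_ring set" and X :: "'x set"
  assumes gen: "strongly_generates S J"
  shows "strongly_generates_over S J X"
  unfolding strongly_generates_over_def
proof (intro allI impI)
  fix r :: "'x \<Rightarrow> 'r"
  assume r: "(\<forall>x\<in>X. r x \<in> J) \<and> converges_to_zero X r"
  define F where "F v = {x \<in> X. r x = v}" for v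
  define e where "e x = (r x, to_nat_on (F (r x)) x)" for x
  define X0 where "X0 = {x \<in> X. r x \<noteq> 0}"
  have fst_e: "fst (e x) = r x" for x by (simp add: e_def)
  have X0_sub: "X0 \<subseteq> X" by (auto simp: X0_def)
  have fin: "finite (F v)" if "v \<noteq> 0" for v
  proof -
    have "finite {x \<in> X. r x \<notin> - {v}}"
      using r[THEN conjunct2, unfolded converges_to_zero_def, rule_format, of "- {v}"] that
      by (simp add: open_Compl)
    then show ?thesis by (simp add: F_def)
  qed
  have inj: "inj_on e X0"
  proof (rule inj_onI)
    fix x y assume xy: "x \<in> X0" "y \<in> X0" "e x = e y"
    then have "r x = r y" and n: "to_nat_on (F (r x)) x = to_nat_on (F (r x)) y"
      by (auto simp: e_def)
    moreover have "inj_on (to_nat_on (F (r x))) (F (r x))"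
      using fin[of "r x"] xy by (intro inj_on_to_nat_on countable_finite) (auto simp: X0_def)
    moreover have "x \<in> F (r x)" and "y \<in> F (r x)"
      using xy \<open>r x = r y\<close> by (simp_all add: F_def X0_def)
    ultimately show "x = y" by (meson inj_onD)
  qed
  have "converges_to_zero (e ` X0) fst"
    unfolding converges_to_zero_def
  proof (intro allI impI)
    fix U :: "'r set" assume "open U \<and> 0 \<in> U"
    then have "finite {x \<in> X. r x \<notin> U}" using r by (auto simp: converges_to_zero_def)
    moreover have "{z \<in> e ` X0. fst z \<notin> U} \<subseteq> e ` {x \<in> X. r x \<notin> U}"
      using fst_e X0_sub by auto
    ultimately show "finite {z \<in> e ` X0. fst z \<notin> U}" by (meson finite_imageI finite_subset)
  qed
  moreover have "\<forall>z\<in>e ` X0. fst z \<in> J" using r fst_e X0_sub by auto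
  ultimately obtain t where t: "\<forall>s\<in>S. converges_to_zero (e ` X0) (t s)"
      "\<forall>z\<in>e ` X0. fst z = (\<Sum>s\<in>S. s * t s z)"
    using gen[unfolded strongly_generates_def, THEN conjunct2, THEN conjunct2, THEN conjunct2,
        rule_format, of "e ` X0", unfolded strongly_generates_over_def, rule_format, of fst]
    by blast
  define u where "u s x = (if x \<in> X0 then t s (e x) else 0)" for s x
  have "converges_to_zero X (u s)" if "s \<in> S" for s
    unfolding converges_to_zero_def
  proof (intro allI impI)
    fix U :: "'r set" assume U: "open U \<and> 0 \<in> U"
    then have "finite {z \<in> e ` X0. t s z \<notin> U}" using t(1) that by (auto simp: converges_to_zero_def)
    moreover have "e ` {x \<in> X. u s x \<notin> U} \<subseteq> {z \<in> e ` X0. t s z \<notin> U}"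
      using U by (auto simp: u_def)
    ultimately have "finite (e ` {x \<in> X. u s x \<notin> U})" by (rule finite_subset[rotated])
    moreover have "inj_on e {x \<in> X. u s x \<notin> U}"
      using U by (intro inj_on_subset[OF inj]) (auto simp: u_def)
    ultimately show "finite {x \<in> X. u s x \<notin> U}" by (rule finite_imageD)
  qed
  moreover have "r x = (\<Sum>s\<in>S. s * u s x)" if "x \<in> X" for x
  proof (cases "x \<in> X0")
    case True
    then have "fst (e x) = (\<Sum>s\<in>S. s * t s (e x))" using t(2) by blast
    with True show ?thesis by (simp add: u_def e_def)
  next
    case False
    with that show ?thesis by (simp add: u_def X0_def)
  qed
  ultimately show "\<exists>t. (\<forall>s\<in>S. converges_to_zero X (t s)) \<and> (\<forall>x\<in>X. r x = (\<Sum>s\<in>S. s * t s x))"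
    by blast
qed


section \<open>The monad of infinite formal linear combinations\<close>

text \<open>
  \<open>formal_combs X\<close> is the set $\mathfrak{R}[[X]]$: a formal combination is its coefficient
  function, extended by zero outside \<open>X\<close>.
\<close>

definition formal_combs :: "'x set \<Rightarrow> ('x \<Rightarrow> 'r::complete_separated_topological_ring) set" where
  "formal_combs X = {r. (\<forall>x. x \<notin> X \<longrightarrow> r x = 0) \<and> converges_to_zero X r}"

definition comb_map ::
    "'x set \<Rightarrow> ('x \<Rightarrow> 'y) \<Rightarrow> ('x \<Rightarrow> 'r::complete_separated_topological_ring) \<Rightarrow> 'y \<Rightarrow> 'r" where
  "comb_map X f r = (\<lambda>y. \<Sum>\<^sub>\<infinity>x\<in>{x \<in> X. f x = y}. r x)"

definition comb_single :: "'r::complete_separated_topological_ring \<Rightarrow> 'x \<Rightarrow> 'x \<Rightarrow> 'r" where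
  "comb_single a x = (\<lambda>y. if y = x then a else 0)"

definition comb_unit :: "'x \<Rightarrow> 'x \<Rightarrow> 'r::complete_separated_topological_ring" where
  "comb_unit x = comb_single 1 x"

text \<open>
  Opening of parentheses: $\sum_r s_r (\sum_x r_x x) = \sum_x (\sum_r s_r r_x) x$.
\<close>

definition comb_mult ::
    "'x set \<Rightarrow> (('x \<Rightarrow> 'r::complete_separated_topological_ring) \<Rightarrow> 'r) \<Rightarrow> 'x \<Rightarrow> 'r" where
  "comb_mult X s = (\<lambda>x. \<Sum>\<^sub>\<infinity>r\<in>formal_combs X. s r * r x)"


section \<open>Categories and functors\<close>

text \<open>
  \<open>cmp C X Y Z g f\<close> is the composite of \<open>f : X \<rightarrow> Y\<close> and \<open>g : Y \<rightarrow> Z\<close>.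
\<close>

record ('o, 'm) category =
  obj :: "'o set"
  hom :: "'o \<Rightarrow> 'o \<Rightarrow> 'm set"
  idn :: "'o \<Rightarrow> 'm"
  cmp :: "'o \<Rightarrow> 'o \<Rightarrow> 'o \<Rightarrow> 'm \<Rightarrow> 'm \<Rightarrow> 'm"

definition is_category :: "('o, 'm) category \<Rightarrow> bool" where
  "is_category C \<longleftrightarrow>
     (\<forall>X\<in>obj C. idn C X \<in> hom C X X) \<and>
     (\<forall>X\<in>obj C. \<forall>Y\<in>obj C. \<forall>Z\<in>obj C. \<forall>f\<in>hom C X Y. \<forall>g\<in>hom C Y Z. cmp C X Y Z g f \<in> hom C X Z) \<and>
     (\<forall>X\<in>obj C. \<forall>Y\<in>obj C. \<forall>f\<in>hom C X Y.
        cmp C X X Y f (idn C X) = f \<and> cmp C X Y Y (idn C Y) f = f) \<and>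
     (\<forall>W\<in>obj C. \<forall>X\<in>obj C. \<forall>Y\<in>obj C. \<forall>Z\<in>obj C.
        \<forall>f\<in>hom C W X. \<forall>g\<in>hom C X Y. \<forall>h\<in>hom C Y Z.
          cmp C W X Z (cmp C X Y Z h g) f = cmp C W Y Z h (cmp C W X Y g f))"

definition is_functor ::
    "('o, 'm) category \<Rightarrow> ('p, 'n) category \<Rightarrow> ('o \<Rightarrow> 'p) \<Rightarrow> ('o \<Rightarrow> 'o \<Rightarrow> 'm \<Rightarrow> 'n) \<Rightarrow> bool" where
  "is_functor C D Fo Fm \<longleftrightarrow>
     is_category C \<and> is_category D \<and>
     (\<forall>X\<in>obj C. Fo X \<in> obj D) \<and>
     (\<forall>X\<in>obj C. \<forall>Y\<in>obj C. \<forall>f\<in>hom C X Y. Fm X Y f \<in> hom D (Fo X) (Fo Y)) \<and>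
     (\<forall>X\<in>obj C. Fm X X (idn C X) = idn D (Fo X)) \<and>
     (\<forall>X\<in>obj C. \<forall>Y\<in>obj C. \<forall>Z\<in>obj C. \<forall>f\<in>hom C X Y. \<forall>g\<in>hom C Y Z.
        Fm X Z (cmp C X Y Z g f) = cmp D (Fo X) (Fo Y) (Fo Z) (Fm Y Z g) (Fm X Y f))"

definition fully_faithful_functor ::
    "('o, 'm) category \<Rightarrow> ('p, 'n) category \<Rightarrow> ('o \<Rightarrow> 'p) \<Rightarrow> ('o \<Rightarrow> 'o \<Rightarrow> 'm \<Rightarrow> 'n) \<Rightarrow> bool" where
  "fully_faithful_functor C D Fo Fm \<longleftrightarrow>
     is_functor C D Fo Fm \<and>
     (\<forall>X\<in>obj C. \<forall>Y\<in>obj C. bij_betw (Fm X Y) (hom C X Y) (hom D (Fo X) (Fo Y)))"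


section \<open>Left contramodules\<close>

record ('r, 'c) contramodule =
  ccarrier :: "'c set"
  cact :: "('c \<Rightarrow> 'r) \<Rightarrow> 'c"

definition is_contramodule ::
    "('r::complete_separated_topological_ring, 'c) contramodule \<Rightarrow> bool" where
  "is_contramodule C \<longleftrightarrow>
     (\<forall>r\<in>formal_combs (ccarrier C). cact C r \<in> ccarrier C) \<and>
     (\<forall>s\<in>formal_combs (formal_combs (ccarrier C)).
        cact C (comb_map (formal_combs (ccarrier C)) (cact C) s) =
        cact C (comb_mult (ccarrier C) s)) \<and>
     (\<forall>c\<in>ccarrier C. cact C (comb_unit c) = c)"

definition contra_hom ::
    "('r::complete_separated_topological_ring, 'c) contramodule \<Rightarrow> ('r, 'd) contramodule
      \<Rightarrow> ('c \<Rightarrow> 'd) set" where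
  "contra_hom C D = {f \<in> ccarrier C \<rightarrow>\<^sub>E ccarrier D.
     \<forall>r\<in>formal_combs (ccarrier C). f (cact C r) = cact D (comb_map (ccarrier C) f r)}"

text \<open>
  Objects are the contramodules carried by subsets of the type \<^typ>\<open>'c\<close>. Any two sets embed in
  a common type, so a statement for arbitrary \<^typ>\<open>'c\<close> covers every pair of contramodules.
  Morphisms are extensional functions, so that hom-set elements are determined by their values on
  the carrier.
\<close>

definition Contra ::
    "(('r::complete_separated_topological_ring, 'c) contramodule, 'c \<Rightarrow> 'c) category" where
  "Contra = \<lparr>obj = {C. is_contramodule C}, hom = contra_hom,
     idn = (\<lambda>C. \<lambda>x\<in>ccarrier C. x), cmp = (\<lambda>X Y Z g f. compose (ccarrier X) g f)\<rparr>"


section \<open>Left modules\<close>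

record ('a, 'm) lmodule =
  mcarrier :: "'m set"
  madd :: "'m \<Rightarrow> 'm \<Rightarrow> 'm"
  mzero :: 'm
  msmult :: "'a \<Rightarrow> 'm \<Rightarrow> 'm"

definition is_lmodule :: "('a::unital_ring, 'm) lmodule \<Rightarrow> bool" where
  "is_lmodule M \<longleftrightarrow>
     mzero M \<in> mcarrier M \<and>
     (\<forall>x\<in>mcarrier M. \<forall>y\<in>mcarrier M. madd M x y \<in> mcarrier M) \<and>
     (\<forall>x\<in>mcarrier M. \<forall>y\<in>mcarrier M. \<forall>z\<in>mcarrier M.
        madd M (madd M x y) z = madd M x (madd M y z)) \<and>
     (\<forall>x\<in>mcarrier M. \<forall>y\<in>mcarrier M. madd M x y = madd M y x) \<and>
     (\<forall>x\<in>mcarrier M. madd M (mzero M) x = x) \<and>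
     (\<forall>x\<in>mcarrier M. \<exists>y\<in>mcarrier M. madd M y x = mzero M) \<and>
     (\<forall>a. \<forall>x\<in>mcarrier M. msmult M a x \<in> mcarrier M) \<and>
     (\<forall>a. \<forall>x\<in>mcarrier M. \<forall>y\<in>mcarrier M.
        msmult M a (madd M x y) = madd M (msmult M a x) (msmult M a y)) \<and>
     (\<forall>a b. \<forall>x\<in>mcarrier M. msmult M (a + b) x = madd M (msmult M a x) (msmult M b x)) \<and>
     (\<forall>a b. \<forall>x\<in>mcarrier M. msmult M (a * b) x = msmult M a (msmult M b x)) \<and>
     (\<forall>x\<in>mcarrier M. msmult M 1 x = x)"

definition lmodule_hom ::
    "('a::unital_ring, 'm) lmodule \<Rightarrow> ('a, 'n) lmodule \<Rightarrow> ('m \<Rightarrow> 'n) set" where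
  "lmodule_hom M N = {f \<in> mcarrier M \<rightarrow>\<^sub>E mcarrier N.
     (\<forall>x\<in>mcarrier M. \<forall>y\<in>mcarrier M. f (madd M x y) = madd N (f x) (f y)) \<and>
     (\<forall>a. \<forall>x\<in>mcarrier M. f (msmult M a x) = msmult N a (f x))}"

definition Mod :: "(('a::unital_ring, 'm) lmodule, 'm \<Rightarrow> 'm) category" where
  "Mod = \<lparr>obj = {M. is_lmodule M}, hom = lmodule_hom,
     idn = (\<lambda>M. \<lambda>x\<in>mcarrier M. x), cmp = (\<lambda>X Y Z g f. compose (mcarrier X) g f)\<rparr>"

definition restrict_scalars :: "('a \<Rightarrow> 'r) \<Rightarrow> ('r, 'm) lmodule \<Rightarrow> ('a, 'm) lmodule" where
  "restrict_scalars \<theta> M = \<lparr>mcarrier = mcarrier M, madd = madd M, mzero = mzero M,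
     msmult = (\<lambda>a. msmult M (\<theta> a))\<rparr>"


section \<open>The forgetful functor\<close>

text \<open>
  The module operations are the values of the contramodule structure map on the finite formal combinations
  $1x + 1y$, $0$ and $ax$.
\<close>

definition underlying_module ::
    "('r::complete_separated_topological_ring, 'c) contramodule \<Rightarrow> ('r, 'c) lmodule" where
  "underlying_module C = \<lparr>mcarrier = ccarrier C,
     madd = (\<lambda>x y. cact C (\<lambda>z. comb_unit x z + comb_unit y z)),
     mzero = cact C (\<lambda>z. 0),
     msmult = (\<lambda>a x. cact C (comb_single a x))\<rparr>"

definition forget_obj ::
    "('a \<Rightarrow> 'r::complete_separated_topological_ring) \<Rightarrow> ('r, 'c) contramodule \<Rightarrow> ('a, 'c) lmodule" where
  "forget_obj \<theta> C = restrict_scalars \<theta> (underlying_module C)"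

definition forget_mor ::
    "('r, 'c) contramodule \<Rightarrow> ('r, 'c) contramodule \<Rightarrow> ('c \<Rightarrow> 'c) \<Rightarrow> 'c \<Rightarrow> 'c" where
  "forget_mor C D f = f"

end

theory Submission
  imports Defs
begin

text \<open>
  Faithfulness is immediate, since the functor does not change underlying maps; the content is that
  a map \<open>f : C \<rightarrow> D\<close> of contramodules which is linear over the dense subring \<open>range \<theta>\<close> respects
  all infinite sums. Its failure to do so is measured by the difference
  $\Delta(r) = f(\sum_x r_x x) - \sum_x r_x f(x)$, a map from formal combinations over \<open>C\<close> to \<open>D\<close>
  which is linear over the dense subring and vanishes on the formal combinations \<open>1 x\<close>.

  Let \<open>J\<close> be an ideal of the base, strongly generated by a finite set \<open>S\<close> in the dense subring. Modulo
  a finite combination with coefficients in the dense subring, killed by $\Delta$, every formal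
  combination \<open>r\<close> has all its coefficients in \<open>J\<close> (density), hence is of the form
  $\sum_{s \in S} s\, q_s$ for formal combinations $q_s$ (strong generation). Therefore
  $\Delta(r) = \sum_{s \in S} s\, \Delta(q_s)$: the image \<open>E\<close> of $\Delta$ satisfies
  $E = \sum_{s \in S} s E$ for each of the countably many ideals of the base
  (\<open>defect_decomposition\<close>).

  A Nakayama-type argument (\<open>nakayama\<close>) then gives \<open>E = 0\<close>. Write \<open>e \<in> E\<close> as a combination of
  elements of \<open>E\<close> with coefficients in $S_0$, each of these as one with coefficients in $S_1$, and so
  on. This produces a finitely branching tree of elements of \<open>E\<close>, where a node \<open>w\<close> of depth \<open>n\<close>
  carries a coefficient in $J_0 \cap \dots \cap J_{n-1}$. The coefficients converge to zero, so the sum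
  over all nodes exists in \<open>D\<close>. Replacing each node by the combination of its children turns the sum
  over all nodes into the sum over all nodes except the root; the two differ by \<open>e\<close>, so \<open>e = 0\<close>.
\<close>

section \<open>Right ideals and right linear topologies\<close>

lemma right_ideal_zero: "right_ideal J \<Longrightarrow> 0 \<in> J"
  by (simp add: right_ideal_def)

lemma right_ideal_diff: "right_ideal J \<Longrightarrow> x \<in> J \<Longrightarrow> y \<in> J \<Longrightarrow> x - y \<in> J"
  by (simp add: right_ideal_def)

lemma right_ideal_mult: "right_ideal J \<Longrightarrow> x \<in> J \<Longrightarrow> x * a \<in> J"
  by (simp add: right_ideal_def)

lemma right_ideal_uminus: "right_ideal J \<Longrightarrow> x \<in> J \<Longrightarrow> - x \<in> J"
  using right_ideal_diff[of J 0 x] right_ideal_zero[of J] by simp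

lemma right_ideal_add: "right_ideal J \<Longrightarrow> x \<in> J \<Longrightarrow> y \<in> J \<Longrightarrow> x + y \<in> J"
  using right_ideal_diff[of J x "- y"] right_ideal_uminus[of J y] by simp

lemma right_ideal_sum: "right_ideal J \<Longrightarrow> (\<And>i. i \<in> I \<Longrightarrow> r i \<in> J) \<Longrightarrow> sum r I \<in> J"
  by (induction I rule: infinite_finite_induct) (auto simp: right_ideal_zero right_ideal_add)

text \<open>The complement of an open subgroup is a union of translates of the subgroup.\<close>

lemma closed_open_right_ideal:
  fixes J :: "'r::complete_separated_topological_ring set"
  assumes J: "open J" "right_ideal J"
  shows "closed J"
proof -
  have eq: "- J = (\<Union>y\<in>- J. (\<lambda>x. x - y) -` J)" (is "_ = ?U")
  proof
    show "- J \<subseteq> ?U"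
      using right_ideal_zero[OF J(2)] by auto
    show "?U \<subseteq> - J"
    proof clarify
      fix x y assume "y \<notin> J" "x - y \<in> J" "x \<in> J"
      then show False
        using right_ideal_diff[OF J(2), of x "x - y"] by simp
    qed
  qed
  have "open ((\<lambda>x. x - y) -` J)" for y
    by (intro open_vimage J continuous_intros)
  then have "open ?U"
    by (intro open_UN) blast
  with eq show ?thesis
    by (simp only: closed_def)
qed

lemma infsum_in_open_right_ideal:
  fixes J :: "'r::complete_separated_topological_ring set"
  assumes J: "open J" "right_ideal J" and r: "\<And>i. i \<in> I \<Longrightarrow> r i \<in> J"
  shows "infsum r I \<in> J"
proof (cases "r summable_on I")
  case True
  then have "(sum r \<longlongrightarrow> infsum r I) (finite_subsets_at_top I)"
    using has_sum_infsum unfolding has_sum_def by blast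
  moreover have "\<forall>\<^sub>F F in finite_subsets_at_top I. sum r F \<in> J"
    using r by (intro eventually_finite_subsets_at_top_weakI right_ideal_sum J) auto
  ultimately show ?thesis
    by (intro Lim_in_closed_set[OF closed_open_right_ideal[OF J]]) auto
next
  case False
  then show ?thesis
    using right_ideal_zero[OF J(2)] by (simp add: infsum_not_exists)
qed

lemma infsum_mult_left:
  fixes r :: "'i \<Rightarrow> 'r::complete_separated_topological_ring"
  assumes "r summable_on I"
  shows "infsum (\<lambda>i. a * r i) I = a * infsum r I"
  using assms
  by (intro infsumI has_sum_homomorphism[where h = "\<lambda>x. a * x"])
    (auto simp: distrib_left intro!: continuous_intros)

lemma infsum_mult_right:
  fixes r :: "'i \<Rightarrow> 'r::complete_separated_topological_ring"
  assumes "r summable_on I"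
  shows "infsum (\<lambda>i. r i * a) I = infsum r I * a"
  using assms
  by (intro infsumI has_sum_homomorphism[where h = "\<lambda>x. x * a"])
    (auto simp: distrib_right intro!: continuous_intros)

lemma converges_to_zero_finite: "finite X \<Longrightarrow> converges_to_zero X r"
  by (simp add: converges_to_zero_def)

lemma converges_to_zero_subset:
  "converges_to_zero X r \<Longrightarrow> Y \<subseteq> X \<Longrightarrow> converges_to_zero Y r"
  unfolding converges_to_zero_def
  by (intro allI impI, rule finite_subset[of _ "{x \<in> X. r x \<notin> U}" for U]) auto

lemma converges_to_zero_cong:
  "(\<And>x. x \<in> X \<Longrightarrow> r x = s x) \<Longrightarrow> converges_to_zero X r \<longleftrightarrow> converges_to_zero X s"
  unfolding converges_to_zero_def by (simp cong: conj_cong)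

locale right_linear_topology =
  fixes \<B> :: "'r::complete_separated_topological_ring set set"
  assumes base: "base_at_zero \<B>"
    and open_base: "J \<in> \<B> \<Longrightarrow> open J"
    and right_ideal_base: "J \<in> \<B> \<Longrightarrow> right_ideal J"
begin

text \<open>
  For families it suffices to test the ideals of the base, and these, unlike general
  neighbourhoods of zero, are closed under sums and right multiplication.
\<close>

lemma converges_to_zero_iff:
  "converges_to_zero X (r :: _ \<Rightarrow> 'r) \<longleftrightarrow> (\<forall>J\<in>\<B>. finite {x \<in> X. r x \<notin> J})"
proof
  assume "converges_to_zero X r"
  then show "\<forall>J\<in>\<B>. finite {x \<in> X. r x \<notin> J}"
    using open_base right_ideal_zero[OF right_ideal_base] by (auto simp: converges_to_zero_def)
next
  assume fin: "\<forall>J\<in>\<B>. finite {x \<in> X. r x \<notin> J}"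
  show "converges_to_zero X r"
    unfolding converges_to_zero_def
  proof (intro allI impI)
    fix U :: "'r set" assume "open U \<and> 0 \<in> U"
    then obtain J where "J \<in> \<B>" "J \<subseteq> U"
      using base by (auto simp: base_at_zero_def)
    then have "{x \<in> X. r x \<notin> U} \<subseteq> {x \<in> X. r x \<notin> J}" "finite {x \<in> X. r x \<notin> J}"
      using fin by auto
    then show "finite {x \<in> X. r x \<notin> U}"
      by (rule finite_subset)
  qed
qed

text \<open>
  Completeness enters here: modulo an open right ideal all but finitely many terms vanish, so the
  finite partial sums form a Cauchy filter.
\<close>

lemma converges_to_zero_summable:
  fixes r :: "'i \<Rightarrow> 'r"
  assumes r: "converges_to_zero I r"
  shows "r summable_on I"
proof -
  let ?F = "filtermap (sum r) (finite_subsets_at_top I)"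
  have "cauchy_filter ?F"
    unfolding cauchy_filter_iff
  proof (intro allI impI)
    fix P :: "'r \<times> 'r \<Rightarrow> bool" assume "eventually P uniformity"
    then obtain Q where Q: "eventually Q (nhds 0)" and QP: "\<And>x y. Q (y - x) \<Longrightarrow> P (x, y)"
      unfolding cauchy_seq_finset_iff_vanishing by (auto simp: eventually_filtercomap)
    obtain U where "open U" "0 \<in> U" and UQ: "\<forall>x\<in>U. Q x"
      using Q by (auto simp: eventually_nhds)
    then obtain J where J: "J \<in> \<B>" and "J \<subseteq> U"
      using base by (auto simp: base_at_zero_def)
    with UQ have JQ: "Q x" if "x \<in> J" for x
      using that by blast
    define F0 where "F0 = {i \<in> I. r i \<notin> J}"
    define \<X> where "\<X> = {F. finite F \<and> F0 \<subseteq> F \<and> F \<subseteq> I}"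
    have F0: "finite F0" "F0 \<subseteq> I"
      using r J by (auto simp: F0_def converges_to_zero_iff)
    have "\<forall>\<^sub>F x in ?F. x \<in> sum r ` \<X>"
      unfolding eventually_filtermap eventually_finite_subsets_at_top
      using F0 by (intro exI[of _ F0]) (auto simp: \<X>_def)
    moreover have "P z" if z_in: "z \<in> sum r ` \<X> \<times> sum r ` \<X>" for z
    proof -
      obtain F G where z: "z = (sum r F, sum r G)" and FG: "F \<in> \<X>" "G \<in> \<X>"
        using z_in by auto
      have split: "sum r H = sum r F0 + sum r (H - F0)" if "H \<in> \<X>" for H
        using that sum.subset_diff[of F0 H r] by (auto simp: \<X>_def add.commute)
      have "sum r (H - F0) \<in> J" if "H \<in> \<X>" for H
        using that by (intro right_ideal_sum right_ideal_base J) (auto simp: \<X>_def F0_def)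
      then have "sum r (G - F0) - sum r (F - F0) \<in> J"
        using FG J by (intro right_ideal_diff right_ideal_base)
      then have "sum r G - sum r F \<in> J"
        using FG by (simp add: split)
      then show ?thesis
        unfolding z by (intro QP JQ)
    qed
    ultimately show "\<exists>X. (\<forall>\<^sub>F x in ?F. x \<in> X) \<and> (\<forall>z\<in>X \<times> X. P z)"
      by blast
  qed
  then have "convergent_filter ?F"
    by (rule cauchy_filter_convergent)
  then show ?thesis
    unfolding summable_on_def has_sum_def filterlim_def by (auto simp: convergent_filter_iff)
qed

lemma converges_to_zero_mult_right:
  fixes r :: "'i \<Rightarrow> 'r"
  assumes r: "converges_to_zero I r"
  shows "converges_to_zero I (\<lambda>i. r i * u i)"
  unfolding converges_to_zero_iff
proof
  fix J assume J: "J \<in> \<B>"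
  have "{i \<in> I. r i * u i \<notin> J} \<subseteq> {i \<in> I. r i \<notin> J}"
    using right_ideal_mult[OF right_ideal_base[OF J]] by auto
  then show "finite {i \<in> I. r i * u i \<notin> J}"
    using r J finite_subset by (auto simp: converges_to_zero_iff)
qed

lemma converges_to_zero_mult_left:
  fixes r :: "'i \<Rightarrow> 'r"
  assumes r: "converges_to_zero I r"
  shows "converges_to_zero I (\<lambda>i. a * r i)"
  unfolding converges_to_zero_def
proof (intro allI impI)
  fix U :: "'r set" assume "open U \<and> 0 \<in> U"
  then have "open ((\<lambda>x. a * x) -` U)" "0 \<in> (\<lambda>x. a * x) -` U"
    by (auto intro!: open_vimage continuous_intros)
  then have "finite {i \<in> I. r i \<notin> (\<lambda>x. a * x) -` U}"
    using r unfolding converges_to_zero_def by blast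
  then show "finite {i \<in> I. a * r i \<notin> U}"
    by simp
qed

lemma converges_to_zero_add:
  fixes r s :: "'i \<Rightarrow> 'r"
  assumes "converges_to_zero I r" "converges_to_zero I s"
  shows "converges_to_zero I (\<lambda>i. r i + s i)"
  unfolding converges_to_zero_iff
proof
  fix J assume J: "J \<in> \<B>"
  have "{i \<in> I. r i + s i \<notin> J} \<subseteq> {i \<in> I. r i \<notin> J} \<union> {i \<in> I. s i \<notin> J}"
    using right_ideal_add[OF right_ideal_base[OF J]] by auto
  moreover have "finite ({i \<in> I. r i \<notin> J} \<union> {i \<in> I. s i \<notin> J})"
    using assms J by (simp add: converges_to_zero_iff)
  ultimately show "finite {i \<in> I. r i + s i \<notin> J}"
    by (rule finite_subset)
qed

text \<open>
  Opening parentheses keeps convergence: for all but finitely many \<open>i\<close> the whole block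
  \<open>r i * t i k\<close> lies in a given open right ideal, and in each remaining block left multiplication
  by \<open>r i\<close> is continuous.
\<close>

lemma converges_to_zero_Sigma:
  fixes r :: "'i \<Rightarrow> 'r"
  assumes r: "converges_to_zero I r" and t: "\<And>i. i \<in> I \<Longrightarrow> converges_to_zero (K i) (t i)"
  shows "converges_to_zero (Sigma I K) (\<lambda>(i, k). r i * t i k)"
  unfolding converges_to_zero_iff
proof
  fix J assume J: "J \<in> \<B>"
  let ?I = "{i \<in> I. r i \<notin> J}"
  let ?K = "\<lambda>i. {k \<in> K i. r i * t i k \<notin> J}"
  have "{p \<in> Sigma I K. (case p of (i, k) \<Rightarrow> r i * t i k) \<notin> J} \<subseteq> Sigma ?I ?K"
    using right_ideal_mult[OF right_ideal_base[OF J]] by auto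
  moreover have "finite ?I"
    using r J by (auto simp: converges_to_zero_iff)
  moreover have "finite (?K i)" if "i \<in> I" for i
    using converges_to_zero_mult_left[OF t[OF that], of "r i"] J by (auto simp: converges_to_zero_iff)
  ultimately show "finite {p \<in> Sigma I K. (case p of (i, k) \<Rightarrow> r i * t i k) \<notin> J}"
    by (elim finite_subset) (auto intro: finite_SigmaI)
qed

lemma infsum_Sigma_mult:
  fixes r :: "'i \<Rightarrow> 'r"
  assumes r: "converges_to_zero I r" and t: "\<And>i. i \<in> I \<Longrightarrow> converges_to_zero (K i) (t i)"
  shows "(\<Sum>\<^sub>\<infinity>i\<in>I. r i * infsum (t i) (K i)) = (\<Sum>\<^sub>\<infinity>(i, k)\<in>Sigma I K. r i * t i k)"
proof -
  have "(\<Sum>\<^sub>\<infinity>i\<in>I. r i * infsum (t i) (K i)) = (\<Sum>\<^sub>\<infinity>i\<in>I. \<Sum>\<^sub>\<infinity>k\<in>K i. r i * t i k)"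
    using t by (intro infsum_cong) (simp add: infsum_mult_left converges_to_zero_summable)
  also have "\<dots> = (\<Sum>\<^sub>\<infinity>(i, k)\<in>Sigma I K. r i * t i k)"
    using assms
    by (intro infsum_Sigma' uniformly_continuous_add converges_to_zero_summable
        converges_to_zero_Sigma converges_to_zero_mult_left)
  finally show ?thesis .
qed

text \<open>
  Summing first over the fibres of \<open>f\<close>. It is the source of both the functoriality of \<open>comb_map\<close> and the
  formula for \<open>comb_mult\<close>.
\<close>

lemma infsum_fibres:
  fixes r :: "'i \<Rightarrow> 'r"
  assumes r: "converges_to_zero I r" and f: "f ` I \<subseteq> Y"
  shows "(\<Sum>\<^sub>\<infinity>y\<in>Y. infsum r {i \<in> I. f i = y}) = infsum r I"
proof -
  let ?S = "SIGMA y:Y. {i \<in> I. f i = y}"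
  have sum: "r summable_on I"
    using r by (rule converges_to_zero_summable)
  have "(\<Sum>\<^sub>\<infinity>y\<in>Y. infsum r {i \<in> I. f i = y}) = (\<Sum>\<^sub>\<infinity>(y, i)\<in>?S. r i)"
  proof (intro infsum_Sigma' uniformly_continuous_add)
    show "(\<lambda>(y, i). r i) summable_on ?S"
      using sum f
      by (subst summable_on_reindex_bij_witness[of _ "\<lambda>i. (f i, i)" snd I r]) auto
    show "r summable_on {i \<in> I. f i = y}" for y
      using sum by (rule summable_on_subset) auto
  qed
  also have "\<dots> = infsum r I"
    using f by (intro infsum_reindex_bij_witness[of _ "\<lambda>i. (f i, i)" snd]) auto
  finally show ?thesis .
qed

end

section \<open>Calculus of formal combinations\<close>

lemma formal_combs_0 [simp]: "(\<lambda>_. 0) \<in> formal_combs X"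
  by (simp add: formal_combs_def converges_to_zero_def)

lemma comb_single_closed [simp]:
  assumes "x \<in> X"
  shows "comb_single a x \<in> formal_combs X"
proof -
  have "finite {y \<in> X. comb_single a x y \<notin> U}" if "0 \<in> U" for U
    using that by (auto simp: comb_single_def intro: finite_subset[of _ "{x}"])
  moreover have "comb_single a x y = 0" if "y \<notin> X" for y
    using assms that by (auto simp: comb_single_def)
  ultimately show ?thesis
    by (simp add: formal_combs_def converges_to_zero_def)
qed

lemma comb_unit_closed [simp]: "x \<in> X \<Longrightarrow> comb_unit x \<in> formal_combs X"
  by (simp add: comb_unit_def)

lemma formal_combsD:
  assumes "r \<in> formal_combs X"
  shows "converges_to_zero X r" "x \<notin> X \<Longrightarrow> r x = 0"
  using assms by (auto simp: formal_combs_def)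

lemma comb_map_cong:
  "(\<And>i. i \<in> I \<Longrightarrow> f i = g i) \<Longrightarrow> (\<And>i. i \<in> I \<Longrightarrow> r i = s i) \<Longrightarrow> comb_map I f r = comb_map I g s"
  unfolding comb_map_def by (intro ext infsum_cong_neutral) auto

lemma comb_map_id: "(\<And>x. x \<notin> X \<Longrightarrow> r x = 0) \<Longrightarrow> comb_map X (\<lambda>x. x) r = r"
proof (rule ext)
  fix y assume 0: "\<And>x. x \<notin> X \<Longrightarrow> r x = 0"
  have "{x \<in> X. x = y} = (if y \<in> X then {y} else {})" by auto
  then show "comb_map X (\<lambda>x. x) r y = r y"
    by (simp add: comb_map_def 0)
qed

lemma comb_map_finite: "finite I \<Longrightarrow> comb_map I f r y = (\<Sum>i\<in>I. if f i = y then r i else 0)"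
  by (simp add: comb_map_def sum.inter_filter)

lemma comb_single_eq_comb_map: "comb_single a x = comb_map {()} (\<lambda>_. x) (\<lambda>_. a)"
  by (auto simp: comb_map_finite comb_single_def)

lemma comb_map_reindex:
  assumes "bij_betw h I K"
  shows "comb_map K f r = comb_map I (f \<circ> h) (r \<circ> h)"
proof
  fix y
  have "bij_betw h {i \<in> I. f (h i) = y} {k \<in> K. f k = y}"
    using assms unfolding bij_betw_def by (auto simp: inj_on_def image_iff)
  then show "comb_map K f r y = comb_map I (f \<circ> h) (r \<circ> h) y"
    unfolding comb_map_def o_def by (simp add: infsum_reindex_bij_betw)
qed

lemma (in right_linear_topology) comb_map_insert:
  fixes r :: "'i \<Rightarrow> 'r"
  assumes r: "converges_to_zero I r" and i: "i \<notin> I"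
  shows "comb_map (insert i I) f r = (\<lambda>y. comb_single (r i) (f i) y + comb_map I f r y)"
proof
  fix y
  have "r summable_on {j \<in> I. f j = y}"
    using r by (intro converges_to_zero_summable converges_to_zero_subset[OF r]) auto
  moreover have "{j \<in> insert i I. f j = y}
      = (if f i = y then insert i {j \<in> I. f j = y} else {j \<in> I. f j = y})"
    by auto
  ultimately show "comb_map (insert i I) f r y = comb_single (r i) (f i) y + comb_map I f r y"
    using i by (auto simp: comb_map_def comb_single_def infsum_insert)
qed

context right_linear_topology
begin

lemma formal_combs_add:
  fixes p q :: "'x \<Rightarrow> 'r"
  shows "p \<in> formal_combs X \<Longrightarrow> q \<in> formal_combs X \<Longrightarrow> (\<lambda>x. p x + q x) \<in> formal_combs X"
  by (simp add: formal_combs_def converges_to_zero_add)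

lemma formal_combs_mult_left:
  fixes p :: "'x \<Rightarrow> 'r"
  shows "p \<in> formal_combs X \<Longrightarrow> (\<lambda>x. a * p x) \<in> formal_combs X"
  by (simp add: formal_combs_def converges_to_zero_mult_left)

lemma formal_combs_diff:
  fixes p q :: "'x \<Rightarrow> 'r"
  shows "p \<in> formal_combs X \<Longrightarrow> q \<in> formal_combs X \<Longrightarrow> (\<lambda>x. p x - q x) \<in> formal_combs X"
  using formal_combs_add[of p X "\<lambda>x. - 1 * q x"] formal_combs_mult_left[of q X "- 1"] by simp

lemma formal_combs_sum:
  fixes p :: "'i \<Rightarrow> 'x \<Rightarrow> 'r"
  shows "(\<And>i. i \<in> I \<Longrightarrow> p i \<in> formal_combs X) \<Longrightarrow> (\<lambda>x. \<Sum>i\<in>I. p i x) \<in> formal_combs X"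
  by (induction I rule: infinite_finite_induct) (auto simp: formal_combs_add)

lemma comb_map_closed:
  fixes r :: "'i \<Rightarrow> 'r"
  assumes f: "f ` I \<subseteq> Y" and r: "converges_to_zero I r"
  shows "comb_map I f r \<in> formal_combs Y"
proof -
  have "comb_map I f r y = 0" if "y \<notin> Y" for y
  proof -
    have "{i \<in> I. f i = y} = {}"
      using f that by auto
    then show ?thesis
      unfolding comb_map_def by (simp only: infsum_empty)
  qed
  moreover have "finite {y \<in> Y. comb_map I f r y \<notin> J}" if J: "J \<in> \<B>" for J
  proof (rule finite_subset)
    show "{y \<in> Y. comb_map I f r y \<notin> J} \<subseteq> f ` {i \<in> I. r i \<notin> J}"
    proof (rule subsetI, rule ccontr)
      fix y assume y: "y \<in> {y \<in> Y. comb_map I f r y \<notin> J}" "y \<notin> f ` {i \<in> I. r i \<notin> J}"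
      then have "comb_map I f r y \<in> J"
        unfolding comb_map_def
        using open_base[OF J] right_ideal_base[OF J] by (intro infsum_in_open_right_ideal) auto
      with y(1) show False by simp
    qed
    show "finite (f ` {i \<in> I. r i \<notin> J})"
      using r J by (auto simp: converges_to_zero_iff)
  qed
  ultimately show ?thesis
    by (simp add: formal_combs_def converges_to_zero_iff)
qed

lemma comb_map_comb_map:
  fixes r :: "'i \<Rightarrow> 'r"
  assumes r: "converges_to_zero I r" and f: "f ` I \<subseteq> X"
  shows "comb_map X g (comb_map I f r) = comb_map I (\<lambda>i. g (f i)) r"
proof
  fix z
  let ?I = "{i \<in> I. g (f i) = z}"
  have "comb_map X g (comb_map I f r) z = (\<Sum>\<^sub>\<infinity>y\<in>{y \<in> X. g y = z}. infsum r {i \<in> ?I. f i = y})"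
    unfolding comb_map_def by (intro infsum_cong arg_cong[of _ _ "infsum r"]) auto
  also have "\<dots> = infsum r ?I"
    using f converges_to_zero_subset[OF r, of ?I] by (intro infsum_fibres) auto
  finally show "comb_map X g (comb_map I f r) z = comb_map I (\<lambda>i. g (f i)) r z"
    unfolding comb_map_def .
qed

lemma comb_map_sum:
  fixes b :: "'i \<Rightarrow> 'r" and q :: "'i \<Rightarrow> 'x \<Rightarrow> 'r"
  assumes "finite I" "\<And>i. i \<in> I \<Longrightarrow> q i \<in> formal_combs X"
  shows "comb_map X f (\<lambda>x. \<Sum>i\<in>I. b i * q i x) = (\<lambda>y. \<Sum>i\<in>I. b i * comb_map X f (q i) y)"
proof
  fix y
  let ?X = "{x \<in> X. f x = y}"
  have q: "q i summable_on ?X" if "i \<in> I" for i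
    using assms(2)[OF that]
    by (intro converges_to_zero_summable converges_to_zero_subset[OF formal_combsD(1)]) auto
  have "((\<lambda>x. \<Sum>i\<in>I. b i * q i x) has_sum (\<Sum>i\<in>I. b i * infsum (q i) ?X)) ?X"
    using assms(1) q
  proof (induction I)
    case (insert i I)
    have "((\<lambda>x. b i * q i x) has_sum (b i * infsum (q i) ?X)) ?X"
      using insert.prems
      by (intro has_sum_homomorphism[where h = "\<lambda>x. b i * x"])
        (auto simp: distrib_left intro!: continuous_intros)
    then show ?case
      using insert by (simp add: has_sum_add)
  qed simp
  then show "comb_map X f (\<lambda>x. \<Sum>i\<in>I. b i * q i x) y = (\<Sum>i\<in>I. b i * comb_map X f (q i) y)"
    unfolding comb_map_def by (rule infsumI)
qed

text \<open>
  A formal combination of formal combinations is usually given as $\sum_i r_i q_i$ with possibly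
  repeating $q_i$; the coefficients of the opened combination can be computed without collecting equal
  terms first.
\<close>

lemma comb_mult_comb_map:
  fixes r :: "'i \<Rightarrow> 'r"
  assumes r: "converges_to_zero I r" and q: "\<And>i. i \<in> I \<Longrightarrow> q i \<in> formal_combs X"
  shows "comb_mult X (comb_map I q r) = (\<lambda>x. \<Sum>\<^sub>\<infinity>i\<in>I. r i * q i x)"
proof
  fix x
  have "comb_mult X (comb_map I q r) x
      = (\<Sum>\<^sub>\<infinity>p\<in>formal_combs X. infsum (\<lambda>i. r i * q i x) {i \<in> I. q i = p})"
    unfolding comb_mult_def comb_map_def
  proof (intro infsum_cong)
    fix p
    have "r summable_on {i \<in> I. q i = p}"
      using converges_to_zero_subset[OF r, of "{i \<in> I. q i = p}"]
      by (intro converges_to_zero_summable) auto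
    then have "infsum r {i \<in> I. q i = p} * p x = infsum (\<lambda>i. r i * p x) {i \<in> I. q i = p}"
      by (simp add: infsum_mult_right)
    also have "\<dots> = infsum (\<lambda>i. r i * q i x) {i \<in> I. q i = p}"
      by (intro infsum_cong) auto
    finally show "infsum r {i \<in> I. q i = p} * p x = infsum (\<lambda>i. r i * q i x) {i \<in> I. q i = p}" .
  qed
  also have "\<dots> = (\<Sum>\<^sub>\<infinity>i\<in>I. r i * q i x)"
    using q by (intro infsum_fibres converges_to_zero_mult_right r) auto
  finally show "comb_mult X (comb_map I q r) x = (\<Sum>\<^sub>\<infinity>i\<in>I. r i * q i x)" .
qed

lemma infsum_mult_comb_map:
  fixes r :: "'i \<Rightarrow> 'r"
  assumes r: "converges_to_zero I r" and t: "\<And>i. i \<in> I \<Longrightarrow> converges_to_zero (K i) (t i)"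
  shows "(\<Sum>\<^sub>\<infinity>i\<in>I. r i * comb_map (K i) (c i) (t i) x)
      = comb_map (Sigma I K) (\<lambda>(i, k). c i k) (\<lambda>(i, k). r i * t i k) x"
proof -
  let ?K = "\<lambda>i. {k \<in> K i. c i k = x}"
  have "(\<Sum>\<^sub>\<infinity>i\<in>I. r i * infsum (t i) (?K i)) = (\<Sum>\<^sub>\<infinity>(i, k)\<in>Sigma I ?K. r i * t i k)"
    using r by (intro infsum_Sigma_mult converges_to_zero_subset[OF t]) auto
  moreover have "Sigma I ?K = {p \<in> Sigma I K. (case p of (i, k) \<Rightarrow> c i k) = x}"
    by auto
  ultimately show ?thesis
    by (simp add: comb_map_def)
qed

end

section \<open>Infinite sums in a contramodule\<close>

text \<open>
  The sum $\sum_i r_i c_i$ of a family indexed by an arbitrary set, with repetitions among the $c_i$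
  allowed. All arguments below are manipulations of such indexed sums.
\<close>

definition contra_sum ::
    "('r::complete_separated_topological_ring, 'c) contramodule \<Rightarrow>
      'i set \<Rightarrow> ('i \<Rightarrow> 'r) \<Rightarrow> ('i \<Rightarrow> 'c) \<Rightarrow> 'c" where
  "contra_sum C I r c = cact C (comb_map I c r)"

definition contra_diff ::
    "('r::complete_separated_topological_ring, 'c) contramodule \<Rightarrow> 'c \<Rightarrow> 'c \<Rightarrow> 'c" where
  "contra_diff C x y = cact C (\<lambda>z. comb_unit x z - comb_unit y z)"

lemma contra_sum_cong:
  "(\<And>i. i \<in> I \<Longrightarrow> r i = s i) \<Longrightarrow> (\<And>i. i \<in> I \<Longrightarrow> c i = d i) \<Longrightarrow>
    contra_sum C I r c = contra_sum C I s d"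
  unfolding contra_sum_def by (simp cong: comb_map_cong)

lemma underlying_module_simps:
  "mcarrier (underlying_module C) = ccarrier C"
  "madd (underlying_module C) x y = cact C (\<lambda>z. comb_unit x z + comb_unit y z)"
  "mzero (underlying_module C) = cact C (\<lambda>z. 0)"
  "msmult (underlying_module C) a x = cact C (comb_single a x)"
  by (simp_all add: underlying_module_def)

lemma comb_unit_add_eq_comb_map:
  "(\<lambda>z. comb_unit x z + comb_unit y z) = comb_map UNIV (\<lambda>b. if b then x else y) (\<lambda>b::bool. 1)"
  by (auto simp: comb_map_finite UNIV_bool comb_unit_def comb_single_def add.commute)

lemma comb_unit_diff_eq_comb_map:
  "(\<lambda>z. comb_unit x z - comb_unit y z)
    = comb_map UNIV (\<lambda>b. if b then x else y) (\<lambda>b::bool. if b then 1 else - 1)"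
  by (auto simp: comb_map_finite UNIV_bool comb_unit_def comb_single_def)

lemma madd_eq_contra_sum:
  "madd (underlying_module C) x y = contra_sum C UNIV (\<lambda>b::bool. 1) (\<lambda>b. if b then x else y)"
  by (simp add: underlying_module_simps contra_sum_def comb_unit_add_eq_comb_map)

lemma contra_diff_eq_contra_sum:
  "contra_diff C x y
    = contra_sum C UNIV (\<lambda>b::bool. if b then 1 else - 1) (\<lambda>b. if b then x else y)"
  by (simp add: contra_diff_def contra_sum_def comb_unit_diff_eq_comb_map)

lemma msmult_eq_contra_sum:
  "msmult (underlying_module C) a x = contra_sum C {()} (\<lambda>_. a) (\<lambda>_. x)"
  by (simp add: underlying_module_simps contra_sum_def comb_single_eq_comb_map)

lemma contra_sum_empty: "contra_sum C {} r c = mzero (underlying_module C)"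
  by (simp add: contra_sum_def comb_map_def underlying_module_simps)

text \<open>
  The base of right ideals is a parameter of the locale because every computation with infinite sums
  in a contramodule rests on convergence in the ring.
\<close>

locale left_contramodule = right_linear_topology \<B>
  for \<B> :: "'r::complete_separated_topological_ring set set" +
  fixes C :: "('r, 'c) contramodule"
  assumes contramodule: "is_contramodule C"
begin

lemma cact_closed: "p \<in> formal_combs (ccarrier C) \<Longrightarrow> cact C p \<in> ccarrier C"
  using contramodule by (simp add: is_contramodule_def)

lemma cact_unit: "x \<in> ccarrier C \<Longrightarrow> cact C (comb_unit x) = x"
  using contramodule by (simp add: is_contramodule_def)

lemma contra_sum_closed:
  fixes r :: "'i \<Rightarrow> 'r"
  shows "converges_to_zero I r \<Longrightarrow> c ` I \<subseteq> ccarrier C \<Longrightarrow> contra_sum C I r c \<in> ccarrier C"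
  unfolding contra_sum_def by (intro cact_closed comb_map_closed)

lemma contra_diff_closed:
  "x \<in> ccarrier C \<Longrightarrow> y \<in> ccarrier C \<Longrightarrow> contra_diff C x y \<in> ccarrier C"
  unfolding contra_diff_def by (intro cact_closed formal_combs_diff comb_unit_closed)

text \<open>
  The associativity axiom for an indexed family of formal combinations. The module operations and the
  rearrangement of double sums are all instances of it.
\<close>

lemma contra_sum_cact:
  fixes r :: "'i \<Rightarrow> 'r"
  assumes r: "converges_to_zero I r" and q: "\<And>i. i \<in> I \<Longrightarrow> q i \<in> formal_combs (ccarrier C)"
  shows "contra_sum C I r (\<lambda>i. cact C (q i)) = cact C (\<lambda>x. \<Sum>\<^sub>\<infinity>i\<in>I. r i * q i x)"
proof -
  let ?F = "formal_combs (ccarrier C)"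
  have "q ` I \<subseteq> ?F"
    using q by auto
  then have "comb_map I q r \<in> formal_combs ?F"
    using r by (rule comb_map_closed)
  then have "cact C (comb_map ?F (cact C) (comb_map I q r)) = cact C (comb_mult (ccarrier C) (comb_map I q r))"
    using contramodule by (simp add: is_contramodule_def)
  then show ?thesis
    using comb_map_comb_map[OF r \<open>q ` I \<subseteq> ?F\<close>, of "cact C"] comb_mult_comb_map[OF r, of q "ccarrier C"] q
    by (simp add: contra_sum_def)
qed

lemma contra_sum_Sigma:
  fixes r :: "'i \<Rightarrow> 'r"
  assumes r: "converges_to_zero I r" and t: "\<And>i. i \<in> I \<Longrightarrow> converges_to_zero (K i) (t i)"
    and c: "\<And>i k. i \<in> I \<Longrightarrow> k \<in> K i \<Longrightarrow> c i k \<in> ccarrier C"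
  shows "contra_sum C I r (\<lambda>i. contra_sum C (K i) (t i) (c i))
      = contra_sum C (Sigma I K) (\<lambda>(i, k). r i * t i k) (\<lambda>(i, k). c i k)"
proof -
  have "contra_sum C I r (\<lambda>i. contra_sum C (K i) (t i) (c i))
      = cact C (\<lambda>x. \<Sum>\<^sub>\<infinity>i\<in>I. r i * comb_map (K i) (c i) (t i) x)"
    unfolding contra_sum_def[of _ "K _"]
    using c by (intro contra_sum_cact r comb_map_closed t) auto
  then show ?thesis
    using r t by (simp add: infsum_mult_comb_map contra_sum_def)
qed

lemma madd_cact:
  assumes "p \<in> formal_combs (ccarrier C)" "q \<in> formal_combs (ccarrier C)"
  shows "madd (underlying_module C) (cact C p) (cact C q) = cact C (\<lambda>x. p x + q x)"
proof -
  have "contra_sum C UNIV (\<lambda>b::bool. 1) (\<lambda>b. cact C (if b then p else q))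
      = cact C (\<lambda>x. \<Sum>\<^sub>\<infinity>b\<in>UNIV. 1 * (if b then p else q) x)"
    using assms by (intro contra_sum_cact converges_to_zero_finite) auto
  moreover have "(\<lambda>b. cact C (if b then p else q)) = (\<lambda>b. if b then cact C p else cact C q)"
    by auto
  ultimately show ?thesis
    by (simp add: madd_eq_contra_sum UNIV_bool add.commute)
qed

lemma contra_diff_cact:
  assumes "p \<in> formal_combs (ccarrier C)" "q \<in> formal_combs (ccarrier C)"
  shows "contra_diff C (cact C p) (cact C q) = cact C (\<lambda>x. p x - q x)"
proof -
  have "contra_sum C UNIV (\<lambda>b::bool. if b then 1 else - 1) (\<lambda>b. cact C (if b then p else q))
      = cact C (\<lambda>x. \<Sum>\<^sub>\<infinity>b\<in>UNIV. (if b then 1 else - 1) * (if b then p else q) x)"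
    using assms by (intro contra_sum_cact converges_to_zero_finite) auto
  moreover have "(\<lambda>b. cact C (if b then p else q)) = (\<lambda>b. if b then cact C p else cact C q)"
    by auto
  ultimately show ?thesis
    by (simp add: contra_diff_eq_contra_sum UNIV_bool)
qed

lemma msmult_cact:
  assumes "p \<in> formal_combs (ccarrier C)"
  shows "msmult (underlying_module C) a (cact C p) = cact C (\<lambda>x. a * p x)"
  using contra_sum_cact[of "{()}" "\<lambda>_. a" "\<lambda>_. p"] assms
  by (simp add: msmult_eq_contra_sum converges_to_zero_finite)

text \<open>
  The structure map is a surjection from the formal combinations onto the contramodule, and by the
  preceding lemmas it turns pointwise operations into module operations. Identities in the contramodule
  thus reduce to pointwise identities in the ring.
\<close>

lemma obtain_comb:
  assumes "x \<in> ccarrier C"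
  obtains p where "p \<in> formal_combs (ccarrier C)" "x = cact C p"
  using cact_unit[OF assms] comb_unit_closed[OF assms] that by metis

lemma is_lmodule_underlying_module: "is_lmodule (underlying_module C)"
proof -
  let ?F = "formal_combs (ccarrier C)"
  let ?M = "underlying_module C"
  have closed: "mzero ?M \<in> ccarrier C"
    "\<And>x y. x \<in> ccarrier C \<Longrightarrow> y \<in> ccarrier C \<Longrightarrow> madd ?M x y \<in> ccarrier C"
    "\<And>a x. x \<in> ccarrier C \<Longrightarrow> msmult ?M a x \<in> ccarrier C"
    by (auto simp: underlying_module_simps formal_combs_add intro!: cact_closed)
  have zero: "mzero ?M = cact C (\<lambda>_. 0)"
    by (simp add: underlying_module_simps)
  note ops = madd_cact msmult_cact formal_combs_add formal_combs_mult_left zero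
  show ?thesis
    unfolding is_lmodule_def underlying_module_simps(1)
  proof (intro conjI ballI allI closed)
    fix x y z a b
    assume "x \<in> ccarrier C" "y \<in> ccarrier C" "z \<in> ccarrier C"
    then obtain p q u where F: "p \<in> ?F" "q \<in> ?F" "u \<in> ?F"
      and xyz: "x = cact C p" "y = cact C q" "z = cact C u"
      by (meson obtain_comb)
    show "madd ?M (madd ?M x y) z = madd ?M x (madd ?M y z)"
      using F by (simp add: xyz ops add.assoc)
    show "madd ?M x y = madd ?M y x"
      using F by (simp add: xyz ops add.commute)
    show "madd ?M (mzero ?M) x = x"
      using F by (simp add: xyz ops)
    show "msmult ?M a (madd ?M x y) = madd ?M (msmult ?M a x) (msmult ?M a y)"
      using F by (simp add: xyz ops distrib_left)
    show "msmult ?M (a + b) x = madd ?M (msmult ?M a x) (msmult ?M b x)"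
      using F by (simp add: xyz ops distrib_right)
    show "msmult ?M (a * b) x = msmult ?M a (msmult ?M b x)"
      using F by (simp add: xyz ops mult.assoc)
    show "msmult ?M 1 x = x"
      using F by (simp add: xyz ops)
    have "madd ?M (msmult ?M (- 1) x) x = mzero ?M"
      using F formal_combs_mult_left[OF F(1), of "- 1"] by (simp add: xyz ops)
    then show "\<exists>y\<in>ccarrier C. madd ?M y x = mzero ?M"
      using closed(3)[OF \<open>x \<in> ccarrier C\<close>] by blast
  qed
qed

lemma eq_if_contra_diff_eq_zero:
  assumes x: "x \<in> ccarrier C" and y: "y \<in> ccarrier C"
    and 0: "contra_diff C x y = mzero (underlying_module C)"
  shows "x = y"
proof -
  obtain p q where F: "p \<in> formal_combs (ccarrier C)" "q \<in> formal_combs (ccarrier C)"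
    and xy: "x = cact C p" "y = cact C q"
    using x y by (meson obtain_comb)
  have "x = madd (underlying_module C) (contra_diff C x y) y"
    using F by (simp add: xy contra_diff_cact madd_cact formal_combs_diff)
  also have "\<dots> = madd (underlying_module C) (mzero (underlying_module C)) y"
    by (simp only: 0)
  also have "\<dots> = y"
    using F by (simp add: xy underlying_module_simps(3) madd_cact)
  finally show ?thesis .
qed

lemma contra_diff_self: "x \<in> ccarrier C \<Longrightarrow> contra_diff C x x = mzero (underlying_module C)"
  by (simp add: contra_diff_def underlying_module_simps)

lemma eq_zero_if_madd_eq:
  assumes x: "x \<in> ccarrier C" and y: "y \<in> ccarrier C"
    and eq: "madd (underlying_module C) x y = y"
  shows "x = mzero (underlying_module C)"
proof -
  obtain p q where F: "p \<in> formal_combs (ccarrier C)" "q \<in> formal_combs (ccarrier C)"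
    and xy: "x = cact C p" "y = cact C q"
    using x y by (meson obtain_comb)
  have "x = contra_diff C (madd (underlying_module C) x y) y"
    using F by (simp add: xy contra_diff_cact madd_cact formal_combs_add)
  then show ?thesis
    using y by (simp add: eq contra_diff_self)
qed

lemma contra_sum_insert:
  fixes r :: "'i \<Rightarrow> 'r"
  assumes r: "converges_to_zero I r" and i: "i \<notin> I" and c: "c ` insert i I \<subseteq> ccarrier C"
  shows "contra_sum C (insert i I) r c
    = madd (underlying_module C) (msmult (underlying_module C) (r i) (c i)) (contra_sum C I r c)"
  using r i c
  by (simp add: contra_sum_def comb_map_insert underlying_module_simps(4) madd_cact comb_map_closed)

lemma contra_sum_zero:
  fixes r :: "'i \<Rightarrow> 'r"
  assumes "converges_to_zero I r"
  shows "contra_sum C I r (\<lambda>_. mzero (underlying_module C)) = mzero (underlying_module C)"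
  using contra_sum_cact[OF assms, of "\<lambda>_ _. 0"] by (simp add: underlying_module_simps)

lemma contra_sum_diff:
  fixes r :: "'i \<Rightarrow> 'r"
  assumes I: "finite I" and c: "c ` I \<subseteq> ccarrier C" and d: "d ` I \<subseteq> ccarrier C"
  shows "contra_sum C I r (\<lambda>i. contra_diff C (c i) (d i))
    = contra_diff C (contra_sum C I r c) (contra_sum C I r d)"
proof -
  have r: "converges_to_zero I r"
    using I by (rule converges_to_zero_finite)
  have unit: "(\<Sum>i\<in>I. r i * comb_unit (h i) x) = comb_map I h r x" for h :: "'i \<Rightarrow> 'c" and x
    using I by (auto simp: comb_map_finite comb_unit_def comb_single_def intro!: sum.cong)
  have "contra_sum C I r (\<lambda>i. contra_diff C (c i) (d i))
      = cact C (\<lambda>x. \<Sum>i\<in>I. r i * (comb_unit (c i) x - comb_unit (d i) x))"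
    using contra_sum_cact[OF r, of "\<lambda>i x. comb_unit (c i) x - comb_unit (d i) x"] I c d
    by (simp add: contra_diff_def formal_combs_diff image_subset_iff)
  also have "\<dots> = cact C (\<lambda>x. comb_map I c r x - comb_map I d r x)"
    by (simp add: right_diff_distrib sum_subtractf unit)
  also have "\<dots> = contra_diff C (contra_sum C I r c) (contra_sum C I r d)"
    using r c d by (simp add: contra_sum_def contra_diff_cact comb_map_closed)
  finally show ?thesis .
qed

end

section \<open>A Nakayama lemma\<close>

text \<open>
  Nodes of the tree are addressed by the list of generators chosen on the way from the root, with the
  most recent choice at the head, so that passing to a child is consing. The child of a node \<open>x\<close>
  of depth \<open>n\<close> along the generator \<open>s\<close> is \<open>g n x s\<close>.
\<close>

primrec tree_path :: "(nat \<Rightarrow> 'r set) \<Rightarrow> 'r list \<Rightarrow> bool" where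
  "tree_path S [] \<longleftrightarrow> True"
| "tree_path S (s # w) \<longleftrightarrow> s \<in> S (length w) \<and> tree_path S w"

primrec tree_node :: "(nat \<Rightarrow> 'c \<Rightarrow> 'r \<Rightarrow> 'c) \<Rightarrow> 'c \<Rightarrow> 'r list \<Rightarrow> 'c" where
  "tree_node g e [] = e"
| "tree_node g e (s # w) = g (length w) (tree_node g e w) s"

lemma finite_tree_paths:
  assumes "\<And>n. finite (S n)"
  shows "finite {w. tree_path S w \<and> length w \<le> n}"
proof (induction n)
  case 0
  have "{w. tree_path S w \<and> length w \<le> 0} \<subseteq> {[]}" by auto
  then show ?case by (rule finite_subset) simp
next
  case (Suc n)
  let ?W = "{w. tree_path S w \<and> length w \<le> n}"
  have "{w. tree_path S w \<and> length w \<le> Suc n}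
      \<subseteq> insert [] ((\<lambda>(w, s). s # w) ` (SIGMA w:?W. S (length w)))" (is "?L \<subseteq> ?R")
  proof
    fix w assume "w \<in> ?L"
    then show "w \<in> ?R"
      by (cases w) (auto intro!: image_eqI[where x = "(_, _)"])
  qed
  moreover have "finite ?R"
    using Suc assms by (auto intro: finite_SigmaI)
  ultimately show ?case by (rule finite_subset)
qed

text \<open>
  The factor chosen at depth \<open>n\<close> lies in \<open>J n\<close>. Later factors multiply it on the right and earlier ones
  on the left, which is why the ideals have to be two-sided.
\<close>

lemma tree_path_prod_in_ideal:
  assumes J: "\<And>n. two_sided_ideal (J n)" and S: "\<And>n. S n \<subseteq> J n"
  shows "tree_path S w \<Longrightarrow> n < length w \<Longrightarrow> prod_list (rev w) \<in> J n"
proof (induction w)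
  case (Cons s w)
  have "right_ideal (J n)" "\<And>a x. x \<in> J n \<Longrightarrow> a * x \<in> J n"
    using J[of n] by (auto simp: two_sided_ideal_def)
  moreover have "prod_list (rev w) \<in> J n \<or> s \<in> J n"
    using Cons S by (cases "n = length w") auto
  ultimately show ?case
    by (auto simp: right_ideal_mult)
qed simp

context left_contramodule
begin

text \<open>
  Every element of \<open>E\<close> is the root of an infinite tree of elements of \<open>E\<close>. The coefficient of a node
  of depth greater than \<open>n\<close> lies in \<open>J n\<close>, and there are only finitely many nodes of depth at most
  \<open>n\<close>, so the sum over the whole tree converges. Expanding each of its terms removes exactly the root.
\<close>

lemma nakayama:
  fixes J S :: "nat \<Rightarrow> 'r set"
  assumes J: "\<And>n. two_sided_ideal (J n)" and J_base: "\<And>U. open U \<Longrightarrow> 0 \<in> U \<Longrightarrow> \<exists>n. J n \<subseteq> U"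
    and S: "\<And>n. S n \<subseteq> J n" "\<And>n. finite (S n)"
    and E: "E \<subseteq> ccarrier C"
    and ex: "\<And>n e. e \<in> E \<Longrightarrow> \<exists>g. g ` S n \<subseteq> E \<and> e = contra_sum C (S n) (\<lambda>s. s) g"
    and e: "e \<in> E"
  shows "e = mzero (underlying_module C)"
proof -
  obtain g where gE: "\<And>n e s. e \<in> E \<Longrightarrow> s \<in> S n \<Longrightarrow> g n e s \<in> E"
    and g: "\<And>n e. e \<in> E \<Longrightarrow> e = contra_sum C (S n) (\<lambda>s. s) (g n e)"
  proof -
    have "\<forall>n e. \<exists>g. e \<in> E \<longrightarrow> g ` S n \<subseteq> E \<and> e = contra_sum C (S n) (\<lambda>s. s) g"
      using ex by meson
    then obtain g where "\<forall>n e. e \<in> E \<longrightarrow> g n e ` S n \<subseteq> E \<and> e = contra_sum C (S n) (\<lambda>s. s) (g n e)"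
      by metis
    then show thesis
      by (intro that[of g]) auto
  qed
  define W where "W = {w. tree_path S w}"
  define cf where "cf w = prod_list (rev w)" for w :: "'r list"
  define nd where "nd = tree_node g e"
  have nd_E: "nd w \<in> E" if "w \<in> W" for w
    using that unfolding W_def nd_def by (induction w) (auto simp: e gE)
  have cf: "converges_to_zero W cf"
    unfolding converges_to_zero_def
  proof (intro allI impI)
    fix U :: "'r set" assume "open U \<and> 0 \<in> U"
    then obtain n where "J n \<subseteq> U"
      using J_base by blast
    then have "cf w \<in> U" if "w \<in> W" "n < length w" for w
      using tree_path_prod_in_ideal[where J = J and S = S, OF J S(1), of w n] that
      unfolding W_def cf_def by blast
    then have "{w \<in> W. cf w \<notin> U} \<subseteq> {w. tree_path S w \<and> length w \<le> n}"
      unfolding W_def by (auto simp flip: not_less)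
    then show "finite {w \<in> W. cf w \<notin> U}"
      by (rule finite_subset) (rule finite_tree_paths[OF S(2)])
  qed
  have cf': "converges_to_zero (W - {[]}) cf"
    using cf by (rule converges_to_zero_subset) auto
  let ?z = "contra_sum C (W - {[]}) cf nd"
  let ?T = "SIGMA w:W. S (length w)"
  have bij: "bij_betw (\<lambda>(w, s). s # w) ?T (W - {[]})"
  proof (rule bij_betw_imageI)
    show "inj_on (\<lambda>(w, s). s # w) ?T"
      by (auto simp: inj_on_def)
    show "(\<lambda>(w, s). s # w) ` ?T = W - {[]}"
    proof
      show "(\<lambda>(w, s). s # w) ` ?T \<subseteq> W - {[]}"
        by (auto simp: W_def)
      show "W - {[]} \<subseteq> (\<lambda>(w, s). s # w) ` ?T"
      proof
        fix v assume v: "v \<in> W - {[]}"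
        then obtain s w where "v = s # w" by (cases v) auto
        with v show "v \<in> (\<lambda>(w, s). s # w) ` ?T"
          by (intro image_eqI[of _ _ "(w, s)"]) (auto simp: W_def)
      qed
    qed
  qed
  \<comment> \<open>Expand every node into its children and open the parentheses.\<close>
  have "contra_sum C W cf nd
      = contra_sum C W cf (\<lambda>w. contra_sum C (S (length w)) (\<lambda>s. s) (\<lambda>s. nd (s # w)))"
    using g[OF nd_E] by (intro contra_sum_cong refl) (simp add: nd_def)
  also have "\<dots> = contra_sum C ?T (\<lambda>(w, s). cf w * s) (\<lambda>(w, s). nd (s # w))"
  proof (intro contra_sum_Sigma cf converges_to_zero_finite S)
    show "nd (s # w) \<in> ccarrier C" if "w \<in> W" "s \<in> S (length w)" for w s
      using nd_E[of "s # w"] that E by (auto simp: W_def)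
  qed
  also have "\<dots> = contra_sum C ?T (cf \<circ> (\<lambda>(w, s). s # w)) (nd \<circ> (\<lambda>(w, s). s # w))"
    by (intro contra_sum_cong) (auto simp: cf_def)
  also have "\<dots> = ?z"
    unfolding contra_sum_def comb_map_reindex[OF bij] ..
  finally have z: "contra_sum C W cf nd = ?z" .
  have "W = insert [] (W - {[]})"
    by (auto simp: W_def)
  then have "contra_sum C W cf nd = contra_sum C (insert [] (W - {[]})) cf nd"
    by simp
  also have "\<dots> = madd (underlying_module C) (msmult (underlying_module C) (cf []) (nd [])) ?z"
    using nd_E E by (intro contra_sum_insert cf') (auto simp: W_def)
  also have "msmult (underlying_module C) (cf []) (nd []) = e"
    using e E msmult_cact[of "comb_unit e" 1] by (auto simp: cf_def nd_def cact_unit)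
  finally have "contra_sum C W cf nd = madd (underlying_module C) e ?z" .
  then have "madd (underlying_module C) e ?z = ?z"
    unfolding z by (rule sym)
  moreover have "?z \<in> ccarrier C"
    using nd_E E by (intro contra_sum_closed cf') auto
  ultimately show ?thesis
    using e E by (intro eq_zero_if_madd_eq[of e ?z]) auto
qed

end

section \<open>The two categories and the forgetful functor\<close>

lemma is_category_Mod: "is_category (Mod :: (('a::unital_ring, 'm) lmodule, 'm \<Rightarrow> 'm) category)"
  unfolding is_category_def
proof (intro conjI ballI)
  fix M N P Q :: "('a, 'm) lmodule" and f g h
  assume obj: "M \<in> obj Mod" "N \<in> obj Mod" "P \<in> obj Mod" "Q \<in> obj Mod"
    and f: "f \<in> hom Mod M N" and g: "g \<in> hom Mod N P" and h: "h \<in> hom Mod P Q"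
  show "cmp Mod M N Q (cmp Mod N P Q h g) f = cmp Mod M P Q h (cmp Mod M N P g f)"
    using f by (auto simp: Mod_def lmodule_hom_def intro!: compose_assoc[symmetric])
next
  fix M :: "('a, 'm) lmodule" assume "M \<in> obj Mod"
  then show "idn Mod M \<in> hom Mod M M"
    by (auto simp: Mod_def lmodule_hom_def is_lmodule_def)
next
  fix M N P :: "('a, 'm) lmodule" and f g
  assume M: "M \<in> obj Mod" and f: "f \<in> hom Mod M N" and g: "g \<in> hom Mod N P"
  have f_closed: "f x \<in> mcarrier N" if "x \<in> mcarrier M" for x
    using f that by (auto simp: Mod_def lmodule_hom_def)
  have closed: "\<And>x y. x \<in> mcarrier M \<Longrightarrow> y \<in> mcarrier M \<Longrightarrow> madd M x y \<in> mcarrier M"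
    "\<And>a x. x \<in> mcarrier M \<Longrightarrow> msmult M a x \<in> mcarrier M"
    using M by (simp_all add: Mod_def is_lmodule_def)
  show "cmp Mod M N P g f \<in> hom Mod M P"
    using f g f_closed by (auto simp: Mod_def lmodule_hom_def compose_def closed)
next
  fix M N :: "('a, 'm) lmodule" and f
  assume "f \<in> hom Mod M N"
  then have f: "f \<in> mcarrier M \<rightarrow>\<^sub>E mcarrier N"
    by (simp add: Mod_def lmodule_hom_def)
  then show "cmp Mod M M N f (idn Mod M) = f" "cmp Mod M N N (idn Mod N) f = f"
    using compose_Id[of f "mcarrier M" "mcarrier N"] Id_compose[of f "mcarrier M" "mcarrier N"]
    by (simp_all add: Mod_def PiE_def)
qed

context right_linear_topology
begin

text \<open>
  Since the module operations are particular sums, morphisms of contramodules are linear.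
\<close>

lemma contra_hom_contra_sum:
  fixes r :: "'i \<Rightarrow> 'r"
  assumes f: "f \<in> contra_hom C D" and r: "converges_to_zero I r" and c: "c ` I \<subseteq> ccarrier C"
  shows "f (contra_sum C I r c) = contra_sum D I r (\<lambda>i. f (c i))"
  using f comb_map_closed[OF c r] comb_map_comb_map[OF r c, of f]
  by (simp add: contra_hom_def contra_sum_def)

lemma contra_hom_subset_lmodule_hom:
  fixes C :: "('r, 'c) contramodule" and D :: "('r, 'd) contramodule"
  shows "contra_hom C D \<subseteq> lmodule_hom (forget_obj \<theta> C) (forget_obj \<theta> D)"
proof
  fix f assume f: "f \<in> contra_hom C D"
  have "f (madd (underlying_module C) x y) = madd (underlying_module D) (f x) (f y)"
    if "x \<in> ccarrier C" "y \<in> ccarrier C" for x y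
    using contra_hom_contra_sum[OF f, of "UNIV :: bool set" "\<lambda>_. 1" "\<lambda>b. if b then x else y"] that
    by (simp add: madd_eq_contra_sum converges_to_zero_finite if_distrib[of f] image_subset_iff)
  moreover have "f (msmult (underlying_module C) a x) = msmult (underlying_module D) a (f x)"
    if "x \<in> ccarrier C" for a x
    using contra_hom_contra_sum[OF f, of "{()}" "\<lambda>_. a" "\<lambda>_. x"] that
    by (simp add: msmult_eq_contra_sum converges_to_zero_finite)
  ultimately show "f \<in> lmodule_hom (forget_obj \<theta> C) (forget_obj \<theta> D)"
    using f by (simp add: lmodule_hom_def contra_hom_def forget_obj_def restrict_scalars_def
        underlying_module_simps(1))
qed

lemma is_category_Contra: "is_category (Contra :: (('r, 'c) contramodule, 'c \<Rightarrow> 'c) category)"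
  unfolding is_category_def
proof (intro conjI ballI)
  fix M N P Q :: "('r, 'c) contramodule" and f g h
  assume obj: "M \<in> obj Contra" "N \<in> obj Contra" "P \<in> obj Contra" "Q \<in> obj Contra"
    and f: "f \<in> hom Contra M N" and g: "g \<in> hom Contra N P" and h: "h \<in> hom Contra P Q"
  show "cmp Contra M N Q (cmp Contra N P Q h g) f = cmp Contra M P Q h (cmp Contra M N P g f)"
    using f by (auto simp: Contra_def contra_hom_def intro!: compose_assoc[symmetric])
next
  fix M :: "('r, 'c) contramodule" assume "M \<in> obj Contra"
  then have closed: "\<And>r. r \<in> formal_combs (ccarrier M) \<Longrightarrow> cact M r \<in> ccarrier M"
    by (simp add: Contra_def is_contramodule_def)
  have "comb_map (ccarrier M) (\<lambda>x\<in>ccarrier M. x) r = r"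
    if "r \<in> formal_combs (ccarrier M)" for r :: "'c \<Rightarrow> 'r"
  proof -
    have "comb_map (ccarrier M) (\<lambda>x\<in>ccarrier M. x) r = comb_map (ccarrier M) (\<lambda>x. x) r"
      by (intro comb_map_cong) auto
    then show ?thesis
      using formal_combsD(2)[OF that] by (simp add: comb_map_id)
  qed
  then show "idn Contra M \<in> hom Contra M M"
    using closed by (auto simp: Contra_def contra_hom_def)
next
  fix M N P :: "('r, 'c) contramodule" and f g
  assume obj: "M \<in> obj Contra" and f: "f \<in> hom Contra M N" and g: "g \<in> hom Contra N P"
  let ?h = "compose (ccarrier M) g f"
  have h: "?h (cact M r) = cact P (comb_map (ccarrier M) ?h r)" if r: "r \<in> formal_combs (ccarrier M)" for r
  proof -
    have fM: "f ` ccarrier M \<subseteq> ccarrier N"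
      using f by (auto simp: Contra_def contra_hom_def)
    have "comb_map (ccarrier M) ?h r = comb_map (ccarrier M) (\<lambda>x. g (f x)) r"
      by (intro comb_map_cong) (auto simp: compose_def)
    also have "\<dots> = comb_map (ccarrier N) g (comb_map (ccarrier M) f r)"
      using fM formal_combsD(1)[OF r] by (simp add: comb_map_comb_map)
    finally show ?thesis
      using f g obj r comb_map_closed[OF fM formal_combsD(1)[OF r]]
      by (simp add: Contra_def contra_hom_def compose_def is_contramodule_def)
  qed
  moreover have "?h \<in> ccarrier M \<rightarrow>\<^sub>E ccarrier P"
    using f g by (auto simp: Contra_def contra_hom_def compose_def)
  ultimately show "cmp Contra M N P g f \<in> hom Contra M P"
    by (simp add: Contra_def contra_hom_def)
next
  fix M N :: "('r, 'c) contramodule" and f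
  assume "f \<in> hom Contra M N"
  then have f: "f \<in> ccarrier M \<rightarrow>\<^sub>E ccarrier N"
    by (simp add: Contra_def contra_hom_def)
  then show "cmp Contra M M N f (idn Contra M) = f" "cmp Contra M N N (idn Contra N) f = f"
    using compose_Id[of f "ccarrier M" "ccarrier N"] Id_compose[of f "ccarrier M" "ccarrier N"]
    by (simp_all add: Contra_def PiE_def)
qed

lemma is_lmodule_forget_obj:
  assumes \<theta>: "unital_ring_hom \<theta>" and C: "is_contramodule (C :: ('r, 'c) contramodule)"
  shows "is_lmodule (forget_obj \<theta> C)"
proof -
  interpret left_contramodule \<B> C
    by unfold_locales (rule C)
  have hom: "\<theta> (a + b) = \<theta> a + \<theta> b" "\<theta> (a * b) = \<theta> a * \<theta> b" "\<theta> 1 = 1" for a b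
    using \<theta> by (simp_all add: unital_ring_hom_def)
  show ?thesis
    using is_lmodule_underlying_module
    unfolding is_lmodule_def forget_obj_def restrict_scalars_def lmodule.simps hom
    by (elim conjE, intro conjI) (assumption | blast)+
qed

lemma is_functor_forget:
  assumes \<theta>: "unital_ring_hom \<theta>"
  shows "is_functor (Contra :: (('r, 'c) contramodule, 'c \<Rightarrow> 'c) category) Mod
    (forget_obj \<theta>) forget_mor"
proof -
  have car: "mcarrier (forget_obj \<theta> C) = ccarrier C" for C :: "('r, 'c) contramodule"
    by (simp add: forget_obj_def restrict_scalars_def underlying_module_simps(1))
  show ?thesis
    unfolding is_functor_def
    using is_category_Contra is_category_Mod is_lmodule_forget_obj[OF \<theta>]
      subsetD[OF contra_hom_subset_lmodule_hom]
    by (auto simp: Contra_def Mod_def forget_mor_def car)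
qed

end

section \<open>Linear maps between contramodules are contramodule morphisms\<close>

text \<open>
  A dense subset meets every translate of an open right ideal, so the finitely many coefficients
  outside the ideal can be moved into it by subtracting elements of the dense subring.
\<close>

lemma obtain_coefficients_near:
  fixes \<theta> :: "'a \<Rightarrow> 'r::complete_separated_topological_ring"
  assumes dense: "closure (range \<theta>) = UNIV" and J: "open J" "right_ideal J"
    and r: "r \<in> formal_combs X"
  obtains a where "finite {x \<in> X. r x \<notin> J}"
    and "\<And>x. r x - (if x \<in> X \<and> r x \<notin> J then \<theta> (a x) else 0) \<in> J"
proof -
  have "\<exists>b. r x - \<theta> b \<in> J" for x
  proof -
    have "open ((\<lambda>y. r x - y) -` J)"
      by (intro open_vimage J continuous_intros)
    moreover have "r x \<in> (\<lambda>y. r x - y) -` J"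
      using right_ideal_zero[OF J(2)] by simp
    ultimately have "(\<lambda>y. r x - y) -` J \<inter> range \<theta> \<noteq> {}"
      using dense by (metis IntI UNIV_I empty_iff open_Int_closure_eq_empty)
    then show ?thesis by auto
  qed
  then obtain a where "\<And>x. r x - \<theta> (a x) \<in> J"
    by metis
  moreover have "finite {x \<in> X. r x \<notin> J}"
    using formal_combsD(1)[OF r] J right_ideal_zero[OF J(2)] by (auto simp: converges_to_zero_def)
  ultimately show thesis
    using formal_combsD(2)[OF r] right_ideal_zero[OF J(2)]
    by (intro that[of a]) auto
qed

text \<open>
  The map $\Delta$: the amount by which \<open>f\<close> fails to commute with the sum given by a formal combination.
\<close>

definition defect ::
    "('c \<Rightarrow> 'd) \<Rightarrow> ('r::complete_separated_topological_ring, 'c) contramodule \<Rightarrow>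
      ('r, 'd) contramodule \<Rightarrow> ('c \<Rightarrow> 'r) \<Rightarrow> 'd" where
  "defect f C D r = contra_diff D (f (cact C r)) (cact D (comb_map (ccarrier C) f r))"

locale linear_map_of_contramodules =
  C: left_contramodule \<B> C + D: left_contramodule \<B> D
  for \<B> :: "'r::complete_separated_topological_ring set set"
    and C :: "('r, 'c) contramodule" and D :: "('r, 'd) contramodule" +
  fixes \<theta> :: "'a::unital_ring \<Rightarrow> 'r" and f :: "'c \<Rightarrow> 'd"
  assumes ring_hom: "unital_ring_hom \<theta>"
    and linear: "f \<in> lmodule_hom (forget_obj \<theta> C) (forget_obj \<theta> D)"
begin

lemma map_closed: "x \<in> ccarrier C \<Longrightarrow> f x \<in> ccarrier D"
  and map_add: "x \<in> ccarrier C \<Longrightarrow> y \<in> ccarrier C \<Longrightarrow>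
    f (madd (underlying_module C) x y) = madd (underlying_module D) (f x) (f y)"
  and map_smult: "x \<in> ccarrier C \<Longrightarrow>
    f (msmult (underlying_module C) (\<theta> a) x) = msmult (underlying_module D) (\<theta> a) (f x)"
  using linear
  by (auto simp: lmodule_hom_def forget_obj_def restrict_scalars_def underlying_module_simps(1))

lemma ring_hom_zero: "\<theta> 0 = 0"
proof -
  have "\<theta> (0 + 0) = \<theta> 0 + \<theta> 0"
    using ring_hom unfolding unital_ring_hom_def by blast
  then show ?thesis
    by simp
qed

lemma map_zero: "f (mzero (underlying_module C)) = mzero (underlying_module D)"
proof -
  let ?z = "mzero (underlying_module C)"
  have z: "?z \<in> ccarrier C"
    by (simp add: underlying_module_simps C.cact_closed)
  obtain p where p: "p \<in> formal_combs (ccarrier D)" "f ?z = cact D p"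
    using D.obtain_comb[OF map_closed[OF z]] .
  have "?z = msmult (underlying_module C) (\<theta> 0) ?z"
    using C.msmult_cact[of "\<lambda>_. 0" "\<theta> 0"] by (simp add: underlying_module_simps(3))
  then have "f ?z = msmult (underlying_module D) (\<theta> 0) (f ?z)"
    using map_smult[OF z] by metis
  also have "\<dots> = mzero (underlying_module D)"
    using p by (simp add: D.msmult_cact ring_hom_zero underlying_module_simps(3))
  finally show ?thesis .
qed

lemma map_contra_sum_finite:
  assumes "finite I" "c ` I \<subseteq> ccarrier C"
  shows "f (contra_sum C I (\<lambda>i. \<theta> (a i)) c) = contra_sum D I (\<lambda>i. \<theta> (a i)) (\<lambda>i. f (c i))"
  using assms
proof (induction I)
  case empty
  show ?case
    by (simp add: contra_sum_empty map_zero)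
next
  case (insert i I)
  have "converges_to_zero I (\<lambda>i. \<theta> (a i))"
    using insert by (simp add: converges_to_zero_finite)
  moreover have "msmult (underlying_module C) (\<theta> (a i)) (c i) \<in> ccarrier C"
    using insert.prems by (simp add: underlying_module_simps(4) C.cact_closed)
  ultimately show ?case
    using insert map_closed
    by (simp add: C.contra_sum_insert D.contra_sum_insert image_subset_iff map_add map_smult
        C.contra_sum_closed)
qed

lemma comb_map_carrier_closed:
  fixes p :: "'c \<Rightarrow> 'r"
  shows "p \<in> formal_combs (ccarrier C) \<Longrightarrow> comb_map (ccarrier C) f p \<in> formal_combs (ccarrier D)"
  by (intro C.comb_map_closed formal_combsD(1)) (auto simp: map_closed)

lemma defect_closed: "p \<in> formal_combs (ccarrier C) \<Longrightarrow> defect f C D p \<in> ccarrier D"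
  unfolding defect_def
  by (intro D.contra_diff_closed map_closed C.cact_closed D.cact_closed comb_map_carrier_closed)

text \<open>
  Both terms of the difference are linear in the formal combination: the first because \<open>f\<close> is linear
  over the dense subring, the second for coefficients from the whole ring.
\<close>

lemma defect_linear:
  assumes I: "finite I" and q: "\<And>i. i \<in> I \<Longrightarrow> q i \<in> formal_combs (ccarrier C)"
  shows "defect f C D (\<lambda>x. \<Sum>i\<in>I. \<theta> (a i) * q i x)
    = contra_sum D I (\<lambda>i. \<theta> (a i)) (\<lambda>i. defect f C D (q i))"
proof -
  let ?a = "\<lambda>i. \<theta> (a i)" and ?f = "comb_map (ccarrier C) f"
  have conv: "converges_to_zero I ?a"
    using I by (rule converges_to_zero_finite)
  have "cact C (\<lambda>x. \<Sum>i\<in>I. ?a i * q i x) = contra_sum C I ?a (\<lambda>i. cact C (q i))"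
    using C.contra_sum_cact[OF conv, of q] q I by simp
  then have "f (cact C (\<lambda>x. \<Sum>i\<in>I. ?a i * q i x)) = contra_sum D I ?a (\<lambda>i. f (cact C (q i)))"
    using q I C.cact_closed by (simp add: map_contra_sum_finite image_subset_iff)
  moreover have "cact D (?f (\<lambda>x. \<Sum>i\<in>I. ?a i * q i x)) = contra_sum D I ?a (\<lambda>i. cact D (?f (q i)))"
    using D.contra_sum_cact[OF conv, of "\<lambda>i. ?f (q i)"] q I
    by (simp add: C.comb_map_sum comb_map_carrier_closed)
  moreover have "contra_sum D I ?a (\<lambda>i. defect f C D (q i))
      = contra_diff D (contra_sum D I ?a (\<lambda>i. f (cact C (q i)))) (contra_sum D I ?a (\<lambda>i. cact D (?f (q i))))"
    unfolding defect_def
    by (intro D.contra_sum_diff I image_subsetI map_closed C.cact_closed D.cact_closed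
        comb_map_carrier_closed q)
  ultimately show ?thesis
    by (simp add: defect_def)
qed

lemma defect_add:
  assumes "p \<in> formal_combs (ccarrier C)" "q \<in> formal_combs (ccarrier C)"
  shows "defect f C D (\<lambda>x. p x + q x) = madd (underlying_module D) (defect f C D p) (defect f C D q)"
proof -
  have "\<theta> 1 = 1"
    using ring_hom by (simp add: unital_ring_hom_def)
  then show ?thesis
    using defect_linear[of "UNIV :: bool set" "\<lambda>b. if b then p else q" "\<lambda>_. 1"] assms
    by (simp add: madd_eq_contra_sum UNIV_bool add.commute if_distrib[of "defect f C D"])
qed

lemma defect_unit:
  assumes x: "x \<in> ccarrier C"
  shows "defect f C D (comb_unit x) = mzero (underlying_module D)"
proof -
  have "(comb_unit x :: 'c \<Rightarrow> 'r) = comb_map {()} (\<lambda>_. x) (\<lambda>_. 1)"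
    by (simp add: comb_unit_def comb_single_eq_comb_map)
  then have "comb_map (ccarrier C) f (comb_unit x :: 'c \<Rightarrow> 'r) = comb_map {()} (\<lambda>_. f x) (\<lambda>_. 1)"
    using x by (simp add: C.comb_map_comb_map converges_to_zero_finite)
  also have "\<dots> = comb_unit (f x)"
    by (simp add: comb_unit_def comb_single_eq_comb_map)
  finally show ?thesis
    using x map_closed by (simp add: defect_def C.cact_unit D.cact_unit D.contra_diff_self)
qed

text \<open>
  After subtracting the finite part \<open>p\<close>, on which the defect vanishes, strong generation applies to the
  whole family of coefficients at once. The generators lie in the dense subring, so they can be pulled
  out of the defect.
\<close>

lemma defect_decomposition:
  assumes dense: "closure (range \<theta>) = UNIV"
    and J: "open J" "right_ideal J" and S: "finite S" "S \<subseteq> range \<theta>" "strongly_generates S J"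
    and r: "r \<in> formal_combs (ccarrier C)"
  obtains q where "\<And>s. s \<in> S \<Longrightarrow> q s \<in> formal_combs (ccarrier C)"
    and "defect f C D r = contra_sum D S (\<lambda>s. s) (\<lambda>s. defect f C D (q s))"
proof -
  let ?X = "ccarrier C"
  define F where "F = {x \<in> ?X. r x \<notin> J}"
  obtain a where "finite F" and J': "\<And>x. r x - (if x \<in> F then \<theta> (a x) else 0) \<in> J"
    using obtain_coefficients_near[OF dense J r] unfolding F_def by auto
  define p where "p x = (\<Sum>y\<in>F. \<theta> (a y) * comb_unit y x)" for x
  have p_eq: "p x = (if x \<in> F then \<theta> (a x) else 0)" for x
    using \<open>finite F\<close>
    by (simp add: p_def comb_unit_def comb_single_def if_distrib[of "\<lambda>t. _ * t"] cong: if_cong)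
  have p: "p \<in> formal_combs ?X"
    unfolding p_def
    by (intro C.formal_combs_sum C.formal_combs_mult_left comb_unit_closed) (auto simp: F_def)
  have "defect f C D p = contra_sum D F (\<lambda>y. \<theta> (a y)) (\<lambda>y. defect f C D (comb_unit y))"
    unfolding p_def using \<open>finite F\<close> by (intro defect_linear) (auto simp: F_def)
  also have "\<dots> = contra_sum D F (\<lambda>y. \<theta> (a y)) (\<lambda>y. mzero (underlying_module D))"
    by (intro contra_sum_cong refl defect_unit) (auto simp: F_def)
  also have "\<dots> = mzero (underlying_module D)"
    using \<open>finite F\<close> by (intro D.contra_sum_zero converges_to_zero_finite)
  finally have defect_p: "defect f C D p = mzero (underlying_module D)" .
  have rp: "(\<lambda>x. r x - p x) \<in> formal_combs ?X"
    using r p by (rule C.formal_combs_diff)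
  moreover have "\<forall>x\<in>?X. r x - p x \<in> J"
    using J' by (simp add: p_eq)
  ultimately obtain t where t: "\<forall>s\<in>S. converges_to_zero ?X (t s)"
    and rt: "\<forall>x\<in>?X. r x - p x = (\<Sum>s\<in>S. s * t s x)"
    using strongly_generates_arbitrary_index[OF S(3), of ?X, unfolded strongly_generates_over_def,
        rule_format, of "\<lambda>x. r x - p x"] formal_combsD(1)
    by blast
  \<comment> \<open>Formal combinations have to vanish outside the carrier, where \<open>t\<close> is arbitrary.\<close>
  define q where "q s x = (if x \<in> ?X then t s x else 0)" for s x
  have q: "q s \<in> formal_combs ?X" if "s \<in> S" for s
    using t that by (auto simp: formal_combs_def q_def cong: converges_to_zero_cong)
  have rq: "r x - p x = (\<Sum>s\<in>S. s * q s x)" for x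
    using rt formal_combsD(2)[OF rp] by (cases "x \<in> ?X") (auto simp: q_def)
  define b where "b = inv_into UNIV \<theta>"
  have b: "\<theta> (b s) = s" if "s \<in> S" for s
    using S(2) that by (auto simp: b_def f_inv_into_f)
  have Sq: "(\<lambda>x. \<Sum>s\<in>S. \<theta> (b s) * q s x) \<in> formal_combs ?X"
    by (intro C.formal_combs_sum C.formal_combs_mult_left q)
  have "r = (\<lambda>x. p x + (\<Sum>s\<in>S. \<theta> (b s) * q s x))"
  proof
    fix x
    have "(\<Sum>s\<in>S. \<theta> (b s) * q s x) = r x - p x"
      unfolding rq by (intro sum.cong refl) (simp add: b)
    then show "r x = p x + (\<Sum>s\<in>S. \<theta> (b s) * q s x)"
      by simp
  qed
  then have "defect f C D r = madd (underlying_module D) (mzero (underlying_module D))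
      (defect f C D (\<lambda>x. \<Sum>s\<in>S. \<theta> (b s) * q s x))"
    using defect_add[OF p Sq] unfolding defect_p
    by (rule trans[OF arg_cong[of r _ "defect f C D"]])
  also have "\<dots> = defect f C D (\<lambda>x. \<Sum>s\<in>S. \<theta> (b s) * q s x)"
    using D.is_lmodule_underlying_module defect_closed[OF Sq]
    by (simp add: is_lmodule_def underlying_module_simps(1))
  also have "\<dots> = contra_sum D S (\<lambda>s. \<theta> (b s)) (\<lambda>s. defect f C D (q s))"
    using S(1) q by (rule defect_linear)
  also have "\<dots> = contra_sum D S (\<lambda>s. s) (\<lambda>s. defect f C D (q s))"
    by (intro contra_sum_cong b refl)
  finally show thesis
    using q by (intro that)
qed

text \<open>
  Countability provides an enumeration of the base, whose \<open>n\<close>-th ideal is used at depth \<open>n\<close> of the tree.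
\<close>

lemma map_in_contra_hom:
  assumes dense: "closure (range \<theta>) = UNIV" and B: "countable \<B>"
    and gen: "\<And>J. J \<in> \<B> \<Longrightarrow> two_sided_ideal J \<and>
      (\<exists>S. finite S \<and> S \<subseteq> range \<theta> \<and> strongly_generates S J)"
  shows "f \<in> contra_hom C D"
proof -
  have "\<B> \<noteq> {}"
    using C.base by (auto simp: base_at_zero_def)
  define J where "J = from_nat_into \<B>"
  have J: "J n \<in> \<B>" for n
    unfolding J_def using \<open>\<B> \<noteq> {}\<close> by (rule from_nat_into)
  have "\<forall>n. \<exists>S. finite S \<and> S \<subseteq> range \<theta> \<and> strongly_generates S (J n)"
    using gen[OF J] by blast
  then obtain S where S: "\<And>n. finite (S n)" "\<And>n. S n \<subseteq> range \<theta>" "\<And>n. strongly_generates (S n) (J n)"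
    by metis
  let ?E = "defect f C D ` formal_combs (ccarrier C)"
  have vanish: "defect f C D r = mzero (underlying_module D)" if r: "r \<in> formal_combs (ccarrier C)" for r
  proof (rule D.nakayama[of J S ?E])
    show "two_sided_ideal (J n)" for n
      using gen[OF J] by simp
    show "\<exists>n. J n \<subseteq> U" if "open U" "0 \<in> U" for U
    proof -
      obtain V where "V \<in> \<B>" "V \<subseteq> U"
        using C.base \<open>open U\<close> \<open>0 \<in> U\<close> by (auto simp: base_at_zero_def)
      then show ?thesis
        using B \<open>\<B> \<noteq> {}\<close> unfolding J_def by (metis range_from_nat_into imageE)
    qed
    show "S n \<subseteq> J n" for n
      using S(3)[of n] by (simp add: strongly_generates_def)
    show "?E \<subseteq> ccarrier D"
      using defect_closed by auto
    show "\<exists>g. g ` S n \<subseteq> ?E \<and> e = contra_sum D (S n) (\<lambda>s. s) g" if e: "e \<in> ?E" for n e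
    proof -
      obtain r where r: "r \<in> formal_combs (ccarrier C)" and e: "e = defect f C D r"
        using e by auto
      obtain q where "\<And>s. s \<in> S n \<Longrightarrow> q s \<in> formal_combs (ccarrier C)"
        and "defect f C D r = contra_sum D (S n) (\<lambda>s. s) (\<lambda>s. defect f C D (q s))"
        using defect_decomposition[OF dense C.open_base[OF J] C.right_ideal_base[OF J]
            S(1)[of n] S(2)[of n] S(3)[of n] r]
        by blast
      then show ?thesis
        unfolding e by (intro exI[of _ "\<lambda>s. defect f C D (q s)"] conjI image_subsetI imageI)
    qed
    show "defect f C D r \<in> ?E"
      using r by (rule imageI)
  qed (rule S(1))
  have "f (cact C r) = cact D (comb_map (ccarrier C) f r)" if "r \<in> formal_combs (ccarrier C)" for r
  proof (rule D.eq_if_contra_diff_eq_zero)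
    show "f (cact C r) \<in> ccarrier D"
      using that by (intro map_closed C.cact_closed)
    show "cact D (comb_map (ccarrier C) f r) \<in> ccarrier D"
      using that by (intro D.cact_closed comb_map_carrier_closed)
    show "contra_diff D (f (cact C r)) (cact D (comb_map (ccarrier C) f r)) = mzero (underlying_module D)"
      using vanish[OF that] by (simp add: defect_def)
  qed
  then show ?thesis
    using linear by (simp add: contra_hom_def lmodule_hom_def forget_obj_def restrict_scalars_def
        underlying_module_simps(1))
qed

end

theorem theorem3p1:
  fixes \<theta> :: "'a::unital_ring \<Rightarrow> 'r::complete_separated_topological_ring"
  assumes "unital_ring_hom \<theta>"
    and "closure (range \<theta>) = UNIV"
    and "\<exists>B. countable B \<and> base_at_zero B \<and>
           (\<forall>J\<in>B. open J \<and> two_sided_ideal J \<and>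
              (\<exists>S. finite S \<and> S \<subseteq> range \<theta> \<and> strongly_generates S J))"
  shows "fully_faithful_functor
           (Contra :: (('r, 'c) contramodule, 'c \<Rightarrow> 'c) category)
           (Mod :: (('a, 'c) lmodule, 'c \<Rightarrow> 'c) category)
           (forget_obj \<theta>) forget_mor"
proof -
  obtain \<B> where \<B>: "countable \<B>" "base_at_zero \<B>"
    and J: "\<And>J. J \<in> \<B> \<Longrightarrow> open J \<and> two_sided_ideal J \<and>
      (\<exists>S. finite S \<and> S \<subseteq> range \<theta> \<and> strongly_generates S J)"
    using assms(3) by blast
  interpret right_linear_topology \<B>
    using \<B> J by unfold_locales (auto simp: two_sided_ideal_def)
  have "contra_hom C D = lmodule_hom (forget_obj \<theta> C) (forget_obj \<theta> D)"
    if "is_contramodule C" "is_contramodule D" for C D :: "('r, 'c) contramodule"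
  proof
    show "contra_hom C D \<subseteq> lmodule_hom (forget_obj \<theta> C) (forget_obj \<theta> D)"
      by (rule contra_hom_subset_lmodule_hom)
    show "lmodule_hom (forget_obj \<theta> C) (forget_obj \<theta> D) \<subseteq> contra_hom C D"
    proof
      fix f assume "f \<in> lmodule_hom (forget_obj \<theta> C) (forget_obj \<theta> D)"
      then interpret linear_map_of_contramodules \<B> C D \<theta> f
        using that assms(1) by unfold_locales
      show "f \<in> contra_hom C D"
        using assms(2) \<B>(1) J by (intro map_in_contra_hom) auto
    qed
  qed
  then show ?thesis
    using is_functor_forget[OF assms(1)]
    by (auto simp: fully_faithful_functor_def Contra_def Mod_def forget_mor_def bij_betw_def inj_on_def)
qed

end
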